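(* Consider $N$ agents with linear dynamics $\dot x_i=A_ix_i+B_iu_i$, $y_i=C_ix_i$ ($i=1,\dots,N$), satisfying the standing assumptions (A1)–(A4) of the context, and let $y^*=(y_1^*,\dots,y_N^* )\in\mathcal Y$ be an optimal solution of the problem of minimizing $\int_0^T f(t,y)\,dt$ over $y\in\mathcal Y$ subject to $\sum_{i=1}^N g_i(t,y_i)\le \mathbf 0$ for all $t\in[0,T]$. Let $\varepsilon>0$, $\sigma>0$, $\iota>0$ and $K_\mu\ge NK_g$, and let every agent apply the event-triggered controller $$u_i=-K_{\alpha_i}x_i+K_{\beta_i}\,\Pi_{\mathcal Y_i}\big[y_i,-\varepsilon \mathcal H_i^{y_i}(t,y_i,\mu_i)\big],\qquad \dot\mu_i=\Pi_{\mathbb R_+^q}\Big[\mu_i,\ \varepsilon g_i(t,y_i)-2\varepsilon K_\mu\sum_{j=1}^N a_{ij}\,\mathrm{sgn}(\hat\mu_i-\hat\mu_j)\Big],\qquad \mu_i(0)=\mathbf 0,$$ where $\hat\mu_i(t)=\mu_i(t_i^l)$ for $t\in[t_i^l,t_i^{l+1})$, $e_i(t)=\hat\mu_i(t)-\mu_i(t)$, and the communication instants of agent $i$ are generated by $$t_i^{l+1}=\inf_{t>t_i^l}\Big\{t\ \Big|\ \|e_i(t)\|\ge \frac{1}{6N\sqrt q}\sum_{j=1}^N a_{ij}\|\hat\mu_i-\hat\mu_j\|_1+\frac{\sigma e^{-\iota t}}{3N^2K_\mu\sqrt q}\Big\}.$$ Then for any $T\ge 0$ the resulting output trajectory $y(t)=\mathrm{col}(y_1(t),\dots,y_N(t))$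 satisfies $$\mathcal F^T:=\left\|\left[\int_0^T\sum_{i=1}^N g_i(t,y_i(t))\,dt\right]_+\right\|\ \le\ \frac{\sqrt N\,\|y(0)-y^*\|}{\varepsilon}+\sqrt{\frac{2N\sigma}{\varepsilon\iota}}+2N\sqrt{\frac{K_f}{\varepsilon}}\,\sqrt T .$$
   Context: Agent $i$ has state $x_i\in\mathbb R^{n_i}$, input $u_i\in\mathbb R^{m_i}$, output $y_i\in\mathbb R^{p_i}$, with real matrices $A_i,B_i,C_i$ of compatible sizes; an output set $\mathcal Y_i\subseteq\mathbb R^{p_i}$; a cost function $f_i(t,\cdot):\mathbb R^{p_i}\to\mathbb R$; and a constraint function $g_i(t,\cdot):\mathbb R^{p_i}\to\mathbb R^q$ with components $g_{i,1},\dots,g_{i,q}$. Write $\mathcal Y=\mathcal Y_1\times\cdots\times\mathcal Y_N$, $y=\mathrm{col}(y_1,\dots,y_N)$ (stacked vector), $f(t,y)=\sum_{i=1}^N f_i(t,y_i)$. Norm $\|\cdot\|$ is Euclidean and $\|\cdot\|_1$ is the 1-norm; vector inequalities are componentwise; $\mathbb R^q_+$ is the nonnegative orthant, and $[\cdot]_+$ is Euclidean projection onto it (componentwise positive part). Standing assumptions. (A1) The communication graph on $\{1,\dots,N\}$ is undirected and connected; $a_{ij}=a_{ji}=1$ if $\{i,j\}$ is an edge and $a_{ij}=0$ otherwise. (A2) Each $\mathcal Y_i$ is convex and compact; for $t\in[0,T]$, $f_i(t,\cdot)$ and (componentwise) $g_i(t,\cdot)$ are convex and bounded on $\mathcal Y_i$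 with $|f_i(t,y_i)|\le K_f$ and $\|g_i(t,y_i)\|\le K_g$ for constants $K_f,K_g>0$, and they are integrable in time (also along the trajectories considered). (A3) The set $\{y\in\mathcal Y:\ \sum_{i=1}^N g_i(t,y_i)\le \mathbf 0\ \text{for all } t\in[0,T]\}$ is nonempty. (A4) $(A_i,B_i)$ is controllable and $\mathrm{rank}(C_iB_i)=p_i$ for each $i$. Feedback matrices: $K_{\alpha_i},K_{\beta_i}$ are any solutions of $C_iB_iK_{\alpha_i}=C_iA_i$ and $C_iB_iK_{\beta_i}=I_{p_i}$ (solutions exist by (A4)). Projection: for a closed convex set $\mathcal S\subseteq\mathbb R^n$, $x\in\mathcal S$, $v\in\mathbb R^n$, $\Pi_{\mathcal S}[x,v]=\lim_{\xi\to0^+}\frac{P_{\mathcal S}(x+\xi v)-x}{\xi}$, where $P_{\mathcal S}$ is Euclidean projection onto $\mathcal S$. Each agent has a multiplier $\mu_i\in\mathbb R^q_+$. $\mathcal H_i^{y_i}(t,y_i,\mu_i)$ denotes an element of $\partial f_i(t,y_i)+\sum_{k=1}^q\mu_{i,k}\,\partial g_{i,k}(t,y_i)$ (a subgradient in $y_i$ of the convex function $f_i(t,y_i)+\mu_i^\top g_i(t,y_i)$). In the event-triggered controller $\mathrm{sgn}$ acts componentwise with $\mathrm{sgn}(s)=-1,0,1$ for $s<0$, $s=0$, $s>0$ respectively. Communication: agent $i$ has communication instants $t_i^1<t_i^2<\cdots$ with $t_i^1=0$ (and $t_i^{l+1}=\infty$ if the triggering set is empty); $\hat\mu_i$ is the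 last broadcast value of $\mu_i$. Trajectories are absolutely continuous functions $(x_i,\mu_i)$ on $[0,T]$ satisfying the closed-loop equations for almost every $t$, with $y_i(t)\in\mathcal Y_i$ (in particular $y_i(0)\in\mathcal Y_i$) and $\mu_i(t)\in\mathbb R^q_+$. *)

theory Defs
  imports "HOL-Analysis.Analysis"
begin

text \<open>
  The agents are the elements of a finite type \<open>'a\<close>, so that \<open>N\<close> is \<open>CARD('a)\<close>.
  Dimensions may differ from agent to agent: the state, input and output spaces of agent \<open>i\<close>
  are coordinate subspaces of common ambient spaces \<open>real^'n\<close>, \<open>real^'m\<close>, \<open>real^'p\<close>,
  spanned by finite sets \<open>X i\<close>, \<open>U i\<close>, \<open>P i\<close> of coordinates, with
  \<open>n\<^sub>i = card (X i)\<close>, \<open>m\<^sub>i = card (U i)\<close>, \<open>p\<^sub>i = card (P i)\<close>.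
  Matrices of agent \<open>i\<close> are padded with zeros accordingly; products, ranks, Euclidean norms and
  inner products agree with those of the unpadded objects.  A stacked output \<open>col(y\<^sub>1,\<dots>,y\<^sub>N)\<close> is
  an element of \<open>real^'p^'a\<close>, whose library norm is the Euclidean norm of the stacked vector.
\<close>

definition coord_space :: "'k::finite set \<Rightarrow> (real^'k) set" where
  "coord_space I = {v. \<forall>k. k \<notin> I \<longrightarrow> v $ k = 0}"

definition coord_mats :: "'r::finite set \<Rightarrow> 'c::finite set \<Rightarrow> (real^'c^'r) set" where
  "coord_mats R C = {M. \<forall>r c. r \<notin> R \<or> c \<notin> C \<longrightarrow> M $ r $ c = 0}"

definition coord_id :: "'k::finite set \<Rightarrow> real^'k^'k" where
  "coord_id I = (\<chi> r c. if r = c \<and> r \<in> I then 1 else 0)"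

definition controllable ::
  "'n::finite set \<Rightarrow> 'm::finite set \<Rightarrow> real^'n^'n \<Rightarrow> real^'m^'n \<Rightarrow> bool" where
  "controllable X U A B \<longleftrightarrow>
     (\<forall>x0\<in>coord_space X. \<forall>x1\<in>coord_space X. \<exists>\<tau>>0. \<exists>w x.
        continuous_on {0..\<tau>} w \<and> w ` {0..\<tau>} \<subseteq> coord_space U \<and>
        (\<forall>t\<in>{0..\<tau>}. (x has_vector_derivative (A *v x t + B *v w t)) (at t within {0..\<tau>})) \<and>
        x 0 = x0 \<and> x \<tau> = x1)"

definition absolutely_cont_on :: "real \<Rightarrow> real \<Rightarrow> (real \<Rightarrow> 'v::real_normed_vector) \<Rightarrow> bool" where
  "absolutely_cont_on a b h \<longleftrightarrow>
     (\<forall>e>0. \<exists>d>0. \<forall>D :: (real \<times> real) set.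
        finite D \<and> (\<forall>(r, s)\<in>D. a \<le> r \<and> r \<le> s \<and> s \<le> b) \<and>
        disjoint_family_on (\<lambda>(r, s). {r<..<s}) D \<and> (\<Sum>(r, s)\<in>D. s - r) < d
        \<longrightarrow> (\<Sum>(r, s)\<in>D. norm (h s - h r)) < e)"

definition proj_dir :: "'v::euclidean_space set \<Rightarrow> 'v \<Rightarrow> 'v \<Rightarrow> 'v" where
  "proj_dir S x v = Lim (at_right 0) (\<lambda>\<xi>::real. (closest_point S (x + \<xi> *\<^sub>R v) - x) /\<^sub>R \<xi>)"

definition nonneg_orthant :: "(real^'k::finite) set" where
  "nonneg_orthant = {v. 0 \<le> v}"

definition pos_part :: "real^'k::finite \<Rightarrow> real^'k" where
  "pos_part v = closest_point nonneg_orthant v"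

lemma pos_part_nth: "pos_part v $ k = max 0 (v $ k)" for v :: "real^'k::finite"
proof -
  have eq: "nonneg_orthant = {w :: real^'k. \<forall>k. 0 \<le> w $ k}"
    by (simp add: nonneg_orthant_def less_eq_vec_def)
  have cv: "convex (nonneg_orthant :: (real^'k) set)"
    unfolding eq convex_def by simp
  have "closed {w :: real^'k. \<forall>k. 0 \<le> w $ k}"
    by (intro closed_Collect_all closed_Collect_le continuous_intros)
  then have cl: "closed (nonneg_orthant :: (real^'k) set)" by (simp add: eq)
  have mem: "(\<chi> k. max 0 (v $ k)) \<in> nonneg_orthant" by (simp add: eq)
  have "\<forall>z\<in>nonneg_orthant. dist v (\<chi> k. max 0 (v $ k)) \<le> dist v z"
  proof
    fix z :: "real^'k" assume z: "z \<in> nonneg_orthant"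
    have "norm ((v - (\<chi> k. max 0 (v $ k))) $ k) \<le> norm ((v - z) $ k)" for k
    proof -
      have "0 \<le> z $ k" using z by (simp add: eq)
      then show ?thesis by (simp add: max_def)
    qed
    then show "dist v (\<chi> k. max 0 (v $ k)) \<le> dist v z"
      unfolding dist_norm by (rule norm_le_componentwise_cart)
  qed
  from closest_point_unique[OF cv cl mem this] show ?thesis
    by (metis pos_part_def vec_lambda_beta)
qed

definition norm1 :: "real^'k::finite \<Rightarrow> real" where
  "norm1 v = (\<Sum>k\<in>UNIV. \<bar>v $ k\<bar>)"

text \<open>The library's \<open>sgn\<close> on \<open>real^'k\<close> is the normalisation \<open>v /\<^sub>R norm v\<close>, not this map.\<close>

definition sgn_vec :: "real^'k::finite \<Rightarrow> real^'k" where
  "sgn_vec v = (\<chi> k. sgn (v $ k))"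

text \<open>
  Subdifferential at \<open>x\<close> of a function that is convex on \<open>S \<subseteq> V\<close>, where \<open>V\<close> is the underlying
  vector space.  As convexity is only available on \<open>S\<close>, the subgradient inequality is required
  on \<open>S\<close>; subgradients in the sense of the whole space \<open>V\<close> are included.
\<close>

definition subdiff ::
  "'v::euclidean_space set \<Rightarrow> 'v set \<Rightarrow> ('v \<Rightarrow> real) \<Rightarrow> 'v \<Rightarrow> 'v set" where
  "subdiff V S \<phi> x = {s \<in> V. \<forall>z\<in>S. \<phi> x + s \<bullet> (z - x) \<le> \<phi> z}"

text \<open>The Minkowski sum \<open>\<partial>\<phi>(x) + \<Sum>k. \<mu>\<^sub>k \<partial>\<gamma>\<^sub>k(x)\<close>.\<close>

definition lagr_subdiff ::
  "'v::euclidean_space set \<Rightarrow> 'v set \<Rightarrow> ('v \<Rightarrow> real) \<Rightarrow> ('v \<Rightarrow> real^'q::finite) \<Rightarrow> 'v \<Rightarrow> real^'q \<Rightarrow> 'v set"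
  where
  "lagr_subdiff V S \<phi> \<gamma> x \<mu> =
     {s + (\<Sum>k\<in>UNIV. (\<mu> $ k) *\<^sub>R r k) | s r.
        s \<in> subdiff V S \<phi> x \<and> (\<forall>k. r k \<in> subdiff V S (\<lambda>z. \<gamma> z $ k) x)}"

definition adj :: "('a \<times> 'a) set \<Rightarrow> 'a \<Rightarrow> 'a \<Rightarrow> real" where
  "adj E i j = (if (i, j) \<in> E then 1 else 0)"

definition feasible ::
  "('a::finite \<Rightarrow> (real^'p::finite) set) \<Rightarrow> ('a \<Rightarrow> real \<Rightarrow> real^'p \<Rightarrow> real^'q::finite) \<Rightarrow> real
     \<Rightarrow> (real^'p^'a) set" where
  "feasible Y g T = {z. (\<forall>i. z $ i \<in> Y i) \<and> (\<forall>t\<in>{0..T}. (\<Sum>i\<in>UNIV. g i t (z $ i)) \<le> 0)}"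

definition total_cost ::
  "('a::finite \<Rightarrow> real \<Rightarrow> real^'p::finite \<Rightarrow> real) \<Rightarrow> real \<Rightarrow> real^'p^'a \<Rightarrow> real" where
  "total_cost f T z = integral {0..T} (\<lambda>t. \<Sum>i\<in>UNIV. f i t (z $ i))"

text \<open>
  \<open>tev i l\<close> is the \<open>(l+1)\<close>-st communication instant of agent \<open>i\<close> (\<open>\<infinity>\<close> if there is none in
  \<open>[0,T]\<close>; the infimum of the empty set is \<open>\<infinity>\<close> in \<open>ereal\<close>).  In the set defining the instant
  after \<open>tev i l\<close>, the agent's own broadcast value is the one sent at \<open>tev i l\<close>, not yet reset;
  so its error is \<open>\<mu> i (tev i l) - \<mu> i t\<close>.
\<close>

definition event_triggered ::
  "('a::finite \<times> 'a) set \<Rightarrow> real \<Rightarrow> real \<Rightarrow> real \<Rightarrow> real \<Rightarrow>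
   ('a \<Rightarrow> real \<Rightarrow> real^'q::finite) \<Rightarrow> ('a \<Rightarrow> nat \<Rightarrow> ereal) \<Rightarrow> ('a \<Rightarrow> real \<Rightarrow> real^'q) \<Rightarrow> bool"
  where
  "event_triggered E K\<mu> \<sigma> \<iota> T \<mu> tev \<mu>h \<longleftrightarrow>
     (\<forall>i. tev i 0 = 0) \<and>
     (\<forall>i l. tev i (Suc l) =
        Inf {ereal t | t. tev i l < ereal t \<and> t \<le> T \<and>
          norm (\<mu> i (real_of_ereal (tev i l)) - \<mu> i t)
            \<ge> 1 / (6 * real CARD('a) * sqrt (real CARD('q))) *
                (\<Sum>j\<in>UNIV. adj E i j * norm1 (\<mu> i (real_of_ereal (tev i l)) - \<mu>h j t))
              + \<sigma> * exp (- \<iota> * t) / (3 * (real CARD('a))\<^sup>2 * K\<mu> * sqrt (real CARD('q)))}) \<and>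
     (\<forall>i l. \<forall>t\<in>{0..T}. tev i l \<le> ereal t \<and> ereal t < tev i (Suc l)
        \<longrightarrow> \<mu>h i t = \<mu> i (real_of_ereal (tev i l)))"

end

theory Submission
  imports Defs
begin

text \<open>
  The proof is a Lyapunov argument with
  \<open>V = 1/2 \<Sum>\<^sub>i \<parallel>y\<^sub>i - y\<^sub>i\<^sup>*\<parallel>\<^sup>2 + 1/2 \<Sum>\<^sub>i \<parallel>\<mu>\<^sub>i - w\<parallel>\<^sup>2\<close> for a fixed \<open>w \<ge> 0\<close>. The feedback matrices turn the
  output dynamics into a projected subgradient flow, and projecting a direction at \<open>x\<close> does not
  increase its inner product with \<open>x - z\<close> for \<open>z\<close> in the set, so \<open>V' / \<epsilon>\<close> is at most
  \<open>2 N Kf - w \<bullet> \<Sum>\<^sub>i g\<^sub>i(y\<^sub>i)\<close> plus a consensus term.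
  Connectedness and \<open>K\<mu> \<ge> N Kg\<close> bound the consensus term by the broadcast errors, and the trigger
  rule bounds these by \<open>\<sigma> exp (- \<iota> t)\<close>; there is no Zeno behaviour because the multipliers are
  uniformly continuous and the trigger threshold is bounded away from \<open>0\<close>. Integrating and choosing
  \<open>w = (\<epsilon> / N) [\<integral> \<Sum>\<^sub>i g\<^sub>i(y\<^sub>i)]\<^sub>+\<close> bounds the square of the left-hand side by the sum of
  the squares of the three terms on the right.
\<close>

section \<open>Absolutely continuous functions and their integrated derivatives\<close>

lemma absolutely_cont_on_imp_uniformly_continuous_on:
  assumes "absolutely_cont_on a b h"
  shows "uniformly_continuous_on {a..b} h"
  unfolding uniformly_continuous_on_def
proof (intro allI impI)
  fix e :: real assume "e > 0"
  with assms obtain d where "d > 0" and d: "\<And>D :: (real \<times> real) set.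
      finite D \<Longrightarrow> (\<forall>(r, s)\<in>D. a \<le> r \<and> r \<le> s \<and> s \<le> b) \<Longrightarrow>
      disjoint_family_on (\<lambda>(r, s). {r<..<s}) D \<Longrightarrow> (\<Sum>(r, s)\<in>D. s - r) < d
      \<Longrightarrow> (\<Sum>(r, s)\<in>D. norm (h s - h r)) < e"
    unfolding absolutely_cont_on_def by meson
  have le: "dist (h s) (h r) < e" if "r \<in> {a..b}" "s \<in> {a..b}" "r \<le> s" "dist s r < d" for r s
    using d[of "{(r, s)}"] that by (simp add: dist_norm disjoint_family_on_def)
  show "\<exists>d>0. \<forall>r\<in>{a..b}. \<forall>s\<in>{a..b}. dist s r < d \<longrightarrow> dist (h s) (h r) < e"
  proof (intro exI[of _ d] conjI ballI impI)
    fix r s assume "r \<in> {a..b}" "s \<in> {a..b}" "dist s r < d"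
    then show "dist (h s) (h r) < e"
      using le[of r s] le[of s r] by (cases "r \<le> s") (auto simp: dist_commute)
  qed fact
qed

lemma absolutely_cont_on_compose_lipschitz:
  assumes h: "absolutely_cont_on a b h"
    and \<phi>: "L-lipschitz_on (h ` {a..b}) \<phi>"
  shows "absolutely_cont_on a b (\<lambda>t. \<phi> (h t))"
  unfolding absolutely_cont_on_def
proof (intro allI impI)
  fix e :: real assume "e > 0"
  have L: "L \<ge> 0" using \<phi> by (rule lipschitz_on_nonneg)
  \<comment> \<open>The \<open>+ 1\<close> covers the case \<open>L = 0\<close>, in which dividing
    by \<open>L\<close> would give no positive tolerance.\<close>
  have "e / (L + 1) > 0" using L \<open>e > 0\<close> by simp
  with h obtain d where "d > 0" and d: "\<And>D :: (real \<times> real) set.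
      finite D \<Longrightarrow> (\<forall>(r, s)\<in>D. a \<le> r \<and> r \<le> s \<and> s \<le> b) \<Longrightarrow>
      disjoint_family_on (\<lambda>(r, s). {r<..<s}) D \<Longrightarrow> (\<Sum>(r, s)\<in>D. s - r) < d
      \<Longrightarrow> (\<Sum>(r, s)\<in>D. norm (h s - h r)) < e / (L + 1)"
    unfolding absolutely_cont_on_def by meson
  show "\<exists>d>0. \<forall>D :: (real \<times> real) set.
      finite D \<and> (\<forall>(r, s)\<in>D. a \<le> r \<and> r \<le> s \<and> s \<le> b) \<and>
      disjoint_family_on (\<lambda>(r, s). {r<..<s}) D \<and> (\<Sum>(r, s)\<in>D. s - r) < d
      \<longrightarrow> (\<Sum>(r, s)\<in>D. norm (\<phi> (h s) - \<phi> (h r))) < e"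
  proof (intro exI[of _ d] conjI allI impI)
    fix D :: "(real \<times> real) set"
    assume D: "finite D \<and> (\<forall>(r, s)\<in>D. a \<le> r \<and> r \<le> s \<and> s \<le> b) \<and>
      disjoint_family_on (\<lambda>(r, s). {r<..<s}) D \<and> (\<Sum>(r, s)\<in>D. s - r) < d"
    let ?S = "\<Sum>(r, s)\<in>D. norm (h s - h r)"
    have S: "?S < e / (L + 1)" using D by (intro d) auto
    have "(\<Sum>(r, s)\<in>D. norm (\<phi> (h s) - \<phi> (h r))) \<le> (\<Sum>(r, s)\<in>D. L * norm (h s - h r))"
    proof (rule sum_mono, clarify)
      fix r s assume "(r, s) \<in> D"
      with D have "r \<in> {a..b}" "s \<in> {a..b}" by auto
      then show "norm (\<phi> (h s) - \<phi> (h r)) \<le> L * norm (h s - h r)"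
        using lipschitz_onD[OF \<phi>, of "h s" "h r"] by (simp add: dist_norm)
    qed
    also have "\<dots> = L * ?S" by (simp add: sum_distrib_left case_prod_unfold)
    also have "\<dots> \<le> (L + 1) * ?S"
      by (intro mult_right_mono sum_nonneg) (auto simp: case_prod_unfold)
    also have "\<dots> < e" using S L by (simp add: field_simps)
    finally show "(\<Sum>(r, s)\<in>D. norm (\<phi> (h s) - \<phi> (h r))) < e" .
  qed fact
qed

text \<open>A difference of squares factorises: the reverse triangle inequality controls the
  difference factor, and boundedness of \<open>S\<close> controls the sum factor, which is unbounded
  on the whole space.\<close>

lemma lipschitz_on_sq_dist:
  fixes S :: "'v::euclidean_space set" and C :: "'v \<Rightarrow> 'w::euclidean_space"
  assumes "bounded S" "bounded_linear C"
  obtains L where "L-lipschitz_on S (\<lambda>w. (norm (C w - c))\<^sup>2 / 2)"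
proof -
  interpret C: bounded_linear C by fact
  obtain R where R: "R > 0" "\<And>w. w \<in> S \<Longrightarrow> norm w \<le> R"
    using assms(1) bounded_pos by blast
  obtain K where K: "K > 0" "\<And>w. norm (C w) \<le> norm w * K" using C.pos_bounded by blast
  define M where "M = R * K + norm c"
  have M: "norm (C w - c) \<le> M" if "w \<in> S" for w
  proof -
    have "norm (C w - c) \<le> norm w * K + norm c"
      using norm_triangle_ineq4[of "C w" c] K(2)[of w] by linarith
    also have "\<dots> \<le> M" using R(2)[OF that] K(1) by (simp add: M_def mult_right_mono)
    finally show ?thesis .
  qed
  have "M \<ge> 0" using R K by (simp add: M_def)
  have "(M * K)-lipschitz_on S (\<lambda>w. (norm (C w - c))\<^sup>2 / 2)"
  proof (rule lipschitz_onI)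
    fix w w' assume w: "w \<in> S" "w' \<in> S"
    let ?p = "norm (C w - c)" and ?q = "norm (C w' - c)"
    have "dist (?p\<^sup>2 / 2) (?q\<^sup>2 / 2) = \<bar>?p - ?q\<bar> * ((?p + ?q) / 2)"
    proof -
      have "?p\<^sup>2 / 2 - ?q\<^sup>2 / 2 = (?p - ?q) * ((?p + ?q) / 2)"
        by (simp add: power2_eq_square field_simps)
      then show ?thesis by (simp only: dist_real_def abs_mult) simp
    qed
    also have "\<dots> \<le> norm (C (w - w')) * M"
    proof (rule mult_mono)
      show "\<bar>?p - ?q\<bar> \<le> norm (C (w - w'))"
        using norm_triangle_ineq3[of "C w - c" "C w' - c"] by (simp add: C.diff)
      show "(?p + ?q) / 2 \<le> M" using M[OF w(1)] M[OF w(2)] by simp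
    qed auto
    also have "\<dots> \<le> M * K * dist w w'"
      using mult_right_mono[OF K(2)[of "w - w'"] \<open>M \<ge> 0\<close>] by (simp add: dist_norm mult_ac)
    finally show "dist (?p\<^sup>2 / 2) (?q\<^sup>2 / 2) \<le> M * K * dist w w'" .
  qed (use \<open>M \<ge> 0\<close> K in auto)
  then show thesis by (rule that)
qed

text \<open>The range of \<open>h\<close> over the compact interval is bounded, as the Lipschitz
  estimate requires. For the outputs \<open>C\<close> will be the output matrix acting on the state,
  for the multipliers the identity.\<close>

lemma absolutely_cont_on_sq_dist:
  fixes h :: "real \<Rightarrow> 'v::euclidean_space" and C :: "'v \<Rightarrow> 'w::euclidean_space"
  assumes h: "absolutely_cont_on a b h" and C: "bounded_linear C"
  shows "absolutely_cont_on a b (\<lambda>t. (norm (C (h t) - c))\<^sup>2 / 2)"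
proof -
  have "compact (h ` {a..b})"
    using absolutely_cont_on_imp_uniformly_continuous_on[OF h]
    by (intro compact_continuous_image uniformly_continuous_imp_continuous) auto
  then obtain L where "L-lipschitz_on (h ` {a..b}) (\<lambda>w. (norm (C w - c))\<^sup>2 / 2)"
    using lipschitz_on_sq_dist C compact_imp_bounded by metis
  then show ?thesis by (rule absolutely_cont_on_compose_lipschitz[OF h])
qed

lemma AE_lebesgue_imp_negligible:
  assumes "AE t in lebesgue. Q t"
  obtains N where "negligible N" "\<And>t. t \<notin> N \<Longrightarrow> Q t"
  using assms by (force simp: eventually_ae_filter negligible_iff_null_sets)

text \<open>The straddle lemma: since the tag \<open>t\<close> lies between \<open>u\<close> and
  \<open>v\<close>, the two one-sided errors add up to a multiple of the length of the
  interval.\<close>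

lemma straddle_derivative:
  fixes h :: "real \<Rightarrow> 'v::real_normed_vector"
  assumes "u \<le> t" "t \<le> v"
    and "norm (h u - h t - (u - t) *\<^sub>R D) \<le> e * norm (u - t)"
    and "norm (h v - h t - (v - t) *\<^sub>R D) \<le> e * norm (v - t)"
  shows "norm ((v - u) *\<^sub>R D - (h v - h u)) \<le> e * (v - u)"
proof -
  have "(v - u) *\<^sub>R D - (h v - h u) =
      (h u - h t - (u - t) *\<^sub>R D) - (h v - h t - (v - t) *\<^sub>R D)"
    by (simp add: algebra_simps)
  also have "norm \<dots> \<le> e * norm (u - t) + e * norm (v - t)"
    using norm_triangle_ineq4[of "h u - h t - (u - t) *\<^sub>R D" "h v - h t - (v - t) *\<^sub>R D"]
      assms(3,4) by linarith
  also have "\<dots> = e * (v - u)" using assms(1,2) by (simp add: algebra_simps)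
  finally show ?thesis .
qed

text \<open>
  The null set where the derivative fails contributes to a Riemann sum only through intervals of
  small total length, which the gauge for its indicator function ensures.
\<close>

lemma fundamental_theorem_of_calculus_absolutely_cont:
  fixes h :: "real \<Rightarrow> 'v::banach"
  assumes "a \<le> b" and h: "absolutely_cont_on a b h"
    and deriv: "AE t in lebesgue. t \<in> {a..b} \<longrightarrow> (h has_vector_derivative h' t) (at t within {a..b})"
  shows "(h' has_integral (h b - h a)) {a..b}"
proof (cases "a = b")
  case True
  then show ?thesis using has_integral_refl(2)[of h' a] by simp
next
  case False
  with \<open>a \<le> b\<close> have "a < b" by simp
  obtain N where N: "negligible N"
    "\<And>t. t \<notin> N \<Longrightarrow> t \<in> {a..b} \<Longrightarrow> (h has_vector_derivative h' t) (at t within {a..b})"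
    using deriv by (auto elim: AE_lebesgue_imp_negligible)
  define k where "k t = (if t \<in> N then 0 else h' t)" for t
  have "(k has_integral (h b - h a)) {a..b}"
    unfolding has_integral_real
  proof (intro allI impI)
    fix e0 :: real assume "e0 > 0"
    \<comment> \<open>Scaled so that the straddle errors over all of \<open>{a..b}\<close> sum to at
      most \<open>e0 / 2\<close>; the other half is left for the tags in \<open>N\<close>.\<close>
    define e where "e = e0 / 2 / (b - a)"
    have "e > 0" using \<open>e0 > 0\<close> \<open>a < b\<close> by (simp add: e_def)
    have "e0 / 2 > 0" using \<open>e0 > 0\<close> by simp
    with h obtain \<delta> where "\<delta> > 0" and \<delta>: "\<And>D :: (real \<times> real) set.
        finite D \<Longrightarrow> (\<forall>(r, s)\<in>D. a \<le> r \<and> r \<le> s \<and> s \<le> b) \<Longrightarrow>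
        disjoint_family_on (\<lambda>(r, s). {r<..<s}) D \<Longrightarrow> (\<Sum>(r, s)\<in>D. s - r) < \<delta>
        \<Longrightarrow> (\<Sum>(r, s)\<in>D. norm (h s - h r)) < e0 / 2"
      unfolding absolutely_cont_on_def by meson
    have "(indicator N has_integral (0::real)) {a..b}"
      using N(1) unfolding negligible_def by (metis box_real(2))
    then obtain \<gamma> where "gauge \<gamma>" and \<gamma>: "\<And>p. p tagged_division_of {a..b} \<Longrightarrow> \<gamma> fine p \<Longrightarrow>
        norm ((\<Sum>(x, K)\<in>p. measure lborel K *\<^sub>R indicator N x) - (0::real)) < \<delta>"
      using \<open>\<delta> > 0\<close> unfolding has_integral_real by meson
    have "\<forall>t. \<exists>d>0. t \<in> {a..b} - N \<longrightarrow>
        (\<forall>s\<in>{a..b}. norm (s - t) < d \<longrightarrow> norm (h s - h t - (s - t) *\<^sub>R h' t) \<le> e * norm (s - t))"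
      using N(2) \<open>e > 0\<close> unfolding has_vector_derivative_def has_derivative_within_alt
      by (metis DiffE zero_less_one)
    then obtain d where d: "\<And>t. d t > 0" "\<And>t s. t \<in> {a..b} - N \<Longrightarrow> s \<in> {a..b} \<Longrightarrow>
        norm (s - t) < d t \<Longrightarrow> norm (h s - h t - (s - t) *\<^sub>R h' t) \<le> e * norm (s - t)"
      by metis
    show "\<exists>\<gamma>. gauge \<gamma> \<and> (\<forall>p. p tagged_division_of {a..b} \<and> \<gamma> fine p \<longrightarrow>
        norm ((\<Sum>(x, K)\<in>p. measure lborel K *\<^sub>R k x) - (h b - h a)) < e0)"
    proof (intro exI[of _ "\<lambda>t. \<gamma> t \<inter> ball t (d t)"] conjI allI impI)
      show "gauge (\<lambda>t. \<gamma> t \<inter> ball t (d t))"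
        using \<open>gauge \<gamma>\<close> d(1) by (intro gauge_Int gauge_ball_dependent) auto
    next
      fix p assume "p tagged_division_of {a..b} \<and> (\<lambda>t. \<gamma> t \<inter> ball t (d t)) fine p"
      then have p: "p tagged_division_of {a..b}" and fine: "\<gamma> fine p" "(\<lambda>t. ball t (d t)) fine p"
        by (auto simp: fine_Int)
      have "finite p" using p by blast
      have K: "\<exists>u v. K = {u..v} \<and> u \<le> t \<and> t \<le> v \<and> a \<le> u \<and> v \<le> b \<and>
          Inf K = u \<and> Sup K = v \<and> measure lborel K = v - u" if "(t, K) \<in> p" for t K
      proof -
        obtain u v where uv: "K = {u..v}" using tagged_division_ofD(4)[OF p] \<open>(t, K) \<in> p\<close> by (metis box_real(2))
        moreover have "t \<in> K" "K \<subseteq> {a..b}" using p that by blast+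
        ultimately show ?thesis by (intro exI[of _ u] exI[of _ v]) (auto simp: atLeastatMost_subset_iff)
      qed
      define q where "q = {(t, K) \<in> p. t \<in> N}"
      have "q \<subseteq> p" "finite q" using \<open>finite p\<close> by (auto simp: q_def intro: finite_subset)
      \<comment> \<open>Absolute continuity speaks of sets of endpoint pairs, so the tags have to be
        forgotten.\<close>
      define b2 where "b2 = (\<lambda>z :: real \<times> real set. (Inf (snd z), Sup (snd z)))"
      have disj: "interior K \<inter> interior K' = {}"
        if "(t, K) \<in> p" "(t', K') \<in> p" "(t, K) \<noteq> (t', K')" for t K t' K'
        using tagged_division_ofD(5)[OF p that(1,2)] that(3) by blast
      \<comment> \<open>Distinct tagged intervals have disjoint interiors. If their endpoints agree,
        they are single points, and then the tags agree as well.\<close>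
      have inj: "inj_on b2 q"
      proof (rule inj_onI, clarify)
        fix t K t' K' assume mem: "(t, K) \<in> q" "(t', K') \<in> q" and eq: "b2 (t, K) = b2 (t', K')"
        have tK: "(t, K) \<in> p" "(t', K') \<in> p" using mem \<open>q \<subseteq> p\<close> by auto
        obtain u v where uv: "K = {u..v}" "u \<le> t" "t \<le> v" "Inf K = u" "Sup K = v"
          using K[OF tK(1)] by auto
        obtain u' v' where uv': "K' = {u'..v'}" "u' \<le> t'" "t' \<le> v'" "Inf K' = u'" "Sup K' = v'"
          using K[OF tK(2)] by auto
        have same: "u' = u" "v' = v" using eq uv(4,5) uv'(4,5) by (auto simp: b2_def)
        show "t = t' \<and> K = K'"
        proof (rule ccontr)
          assume "\<not> (t = t' \<and> K = K')"
          then have "interior K \<inter> interior K' = {}" using disj[OF tK] by auto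
          then have "{u<..<v} = {}" using uv(1) uv'(1) same by (simp add: interior_atLeastAtMost_real)
          then have "v \<le> u" using dense[of u v] by force
          then have "t = t'" using uv(2,3) uv'(2,3) same by linarith
          then show False using \<open>\<not> (t = t' \<and> K = K')\<close> uv(1) uv'(1) same by simp
        qed
      qed
      have "(\<Sum>(r, s)\<in>b2 ` q. norm (h s - h r)) < e0 / 2"
      proof (rule \<delta>)
        show "finite (b2 ` q)" using \<open>finite q\<close> by simp
        show "\<forall>(r, s)\<in>b2 ` q. a \<le> r \<and> r \<le> s \<and> s \<le> b"
          using K \<open>q \<subseteq> p\<close> by (fastforce simp: b2_def)
        show "disjoint_family_on (\<lambda>(r, s). {r<..<s}) (b2 ` q)"
          unfolding disjoint_family_on_def
        proof (intro ballI impI)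
          fix z z' assume "z \<in> b2 ` q" "z' \<in> b2 ` q" and "z \<noteq> z'"
          then obtain t L t' L' where mem: "(t, L) \<in> q" "(t', L') \<in> q"
            and z: "z = b2 (t, L)" "z' = b2 (t', L')" by (metis imageE surj_pair)
          have tL: "(t, L) \<in> p" "(t', L') \<in> p" using mem \<open>q \<subseteq> p\<close> by auto
          have "(t, L) \<noteq> (t', L')" using z \<open>z \<noteq> z'\<close> by metis
          then have "interior L \<inter> interior L' = {}" using disj[OF tL] by simp
          then have "{Inf L<..<Sup L} \<inter> {Inf L'<..<Sup L'} = {}"
            using K[OF tL(1)] K[OF tL(2)] interior_atLeastAtMost_real by metis
          then show "(case z of (r, s) \<Rightarrow> {r<..<s}) \<inter> (case z' of (r, s) \<Rightarrow> {r<..<s}) = {}"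
            by (simp add: z b2_def)
        qed
        have "(\<Sum>(r, s)\<in>b2 ` q. s - r) = (\<Sum>(t, K)\<in>q. measure lborel K)"
        proof (subst sum.reindex[OF inj], rule sum.cong[OF refl])
          fix z assume "z \<in> q"
          then have "z \<in> p" using \<open>q \<subseteq> p\<close> by blast
          with K[of "fst z" "snd z"]
          show "((\<lambda>(r, s). s - r) \<circ> b2) z = (case z of (t, K) \<Rightarrow> measure lborel K)"
            by (auto simp: b2_def case_prod_unfold)
        qed
        also have "\<dots> = (\<Sum>(t, K)\<in>p. measure lborel K *\<^sub>R indicator N t)"
          using \<open>finite p\<close> by (intro sum.mono_neutral_cong_left) (auto simp: q_def indicator_def)
        also have "\<dots> < \<delta>" using \<gamma>[OF p fine(1)] by simp
        finally show "(\<Sum>(r, s)\<in>b2 ` q. s - r) < \<delta>" .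
      qed
      then have q_sum: "(\<Sum>(t, K)\<in>q. norm (h (Sup K) - h (Inf K))) < e0 / 2"
        by (subst (asm) sum.reindex[OF inj]) (simp add: b2_def case_prod_unfold o_def)
      have p_sum: "(\<Sum>(t, K)\<in>p. Sup K - Inf K) = b - a"
        and h_sum: "(\<Sum>(t, K)\<in>p. h (Sup K) - h (Inf K)) = h b - h a"
        using additive_tagged_division_1[OF \<open>a \<le> b\<close> p] by auto
      have "(\<Sum>(t, K)\<in>p. measure lborel K *\<^sub>R k t) - (h b - h a) =
          (\<Sum>(t, K)\<in>p. measure lborel K *\<^sub>R k t - (h (Sup K) - h (Inf K)))"
        by (simp add: h_sum[symmetric] sum_subtractf case_prod_unfold)
      \<comment> \<open>A tag outside \<open>N\<close> costs a straddle error; a tag in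
        \<open>N\<close> costs only the increment of \<open>h\<close>, because \<open>k\<close>
        vanishes there.\<close>
      also have "norm \<dots> \<le> (\<Sum>(t, K)\<in>p. e * (Sup K - Inf K) +
          (if (t, K) \<in> q then norm (h (Sup K) - h (Inf K)) else 0))"
      proof (rule sum_norm_le, clarify)
        fix t L assume tL: "(t, L) \<in> p"
        obtain u v where uv: "L = {u..v}" "u \<le> t" "t \<le> v" "a \<le> u" "v \<le> b"
          "Inf L = u" "Sup L = v" "measure lborel L = v - u" using K[OF tL] by auto
        show "norm (measure lborel L *\<^sub>R k t - (h (Sup L) - h (Inf L))) \<le> e * (Sup L - Inf L) +
          (if (t, L) \<in> q then norm (h (Sup L) - h (Inf L)) else 0)"
        proof (cases "t \<in> N")
          case True
          then show ?thesis using tL uv \<open>e > 0\<close> by (simp add: q_def k_def norm_minus_commute)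
        next
          case False
          have "L \<subseteq> ball t (d t)" using fine(2) tL by (auto simp: fine_def)
          moreover have "u \<in> L" "v \<in> L" using uv by auto
          ultimately have "u \<in> ball t (d t)" "v \<in> ball t (d t)" by auto
          then have "norm ((v - u) *\<^sub>R h' t - (h v - h u)) \<le> e * (v - u)"
            using uv False
            by (intro straddle_derivative[OF uv(2,3)] d(2)) (auto simp: dist_norm norm_minus_commute abs_minus_commute)
          then show ?thesis using False uv by (simp add: q_def k_def)
        qed
      qed
      also have "\<dots> = e * (\<Sum>(t, K)\<in>p. Sup K - Inf K) +
          (\<Sum>(t, K)\<in>q. norm (h (Sup K) - h (Inf K)))"
      proof -
        have "(\<Sum>z\<in>p. if z \<in> q then norm (h (Sup (snd z)) - h (Inf (snd z))) else 0) =
            (\<Sum>z\<in>q. norm (h (Sup (snd z)) - h (Inf (snd z))))"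
          using \<open>finite p\<close> \<open>q \<subseteq> p\<close> by (intro sum.mono_neutral_cong_right) auto
        then show ?thesis by (simp add: case_prod_unfold sum.distrib sum_distrib_left)
      qed
      also have "\<dots> < e0"
      proof -
        have "e * (b - a) = e0 / 2" using \<open>a < b\<close> e_def by (metis less_irrefl nonzero_eq_divide_eq right_minus_eq)
        then show ?thesis using q_sum unfolding p_sum by linarith
      qed
      finally show "norm ((\<Sum>(x, K)\<in>p. measure lborel K *\<^sub>R k x) - (h b - h a)) < e0" .
    qed
  qed
  then show ?thesis
    by (rule has_integral_spike[OF N(1), rotated]) (auto simp: k_def)
qed

section \<open>Projected directions\<close>

text \<open>The obtuse-angle criterion for the projected point, which is
  \<open>x + \<xi> *\<^sub>R d\<close>, divided by \<open>\<xi>\<close>. In this form it can be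
  compared across step sizes and passed to the limit.\<close>

lemma closest_point_quotient_inner_le:
  fixes S :: "'v::euclidean_space set" and x v :: 'v
  assumes S: "convex S" "closed S" and "z \<in> S" and "\<xi> > 0"
  defines "d \<equiv> (closest_point S (x + \<xi> *\<^sub>R v) - x) /\<^sub>R \<xi>"
  shows "(v - d) \<bullet> (z - x - \<xi> *\<^sub>R d) \<le> 0"
proof -
  let ?P = "closest_point S (x + \<xi> *\<^sub>R v)"
  have P: "?P = x + \<xi> *\<^sub>R d" using \<open>\<xi> > 0\<close> by (simp add: d_def)
  have "(x + \<xi> *\<^sub>R v - ?P) \<bullet> (z - ?P) \<le> 0" using closest_point_dot[OF S \<open>z \<in> S\<close>] .
  then have "\<xi> * ((v - d) \<bullet> (z - x - \<xi> *\<^sub>R d)) \<le> 0"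
    unfolding P by (simp add: algebra_simps inner_simps)
  then show ?thesis using \<open>\<xi> > 0\<close> by (simp add: mult_le_0_iff)
qed

text \<open>
  The quotients are the projections of \<open>v\<close> onto the sets \<open>(S - x) / \<xi>\<close>, which increase as
  \<open>\<xi>\<close> decreases. So the distances of \<open>v\<close> from them decrease to a limit, and the
  obtuse-angle criterion turns this into the Cauchy property.
\<close>

lemma proj_dir_tendsto:
  fixes S :: "'v::euclidean_space set"
  assumes S: "convex S" "closed S" and "x \<in> S"
  shows "((\<lambda>\<xi>. (closest_point S (x + \<xi> *\<^sub>R v) - x) /\<^sub>R \<xi>) \<longlongrightarrow> proj_dir S x v) (at_right 0)"
proof -
  define d where "d \<xi> = (closest_point S (x + \<xi> *\<^sub>R v) - x) /\<^sub>R \<xi>" for \<xi>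
  define r where "r \<xi> = (norm (v - d \<xi>))\<^sup>2" for \<xi>
  have d_mem: "x + \<xi> *\<^sub>R d \<xi> \<in> S" if "\<xi> > 0" for \<xi>
    using closest_point_in_set[OF S(2)] \<open>x \<in> S\<close> that by (auto simp: d_def)
  have dist_le: "(norm (d \<xi> - d \<eta>))\<^sup>2 \<le> r \<eta> - r \<xi>" if "0 < \<xi>" "\<xi> \<le> \<eta>" for \<xi> \<eta>
  proof -
    \<comment> \<open>By convexity the quotient for the larger step \<open>\<eta>\<close> also gives
      a point of \<open>S\<close> at the smaller step \<open>\<xi>\<close>, which serves as the test
      point there.\<close>
    have "(1 - \<xi> / \<eta>) *\<^sub>R x + (\<xi> / \<eta>) *\<^sub>R (x + \<eta> *\<^sub>R d \<eta>) \<in> S"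
      using that by (intro convexD[OF S(1)] \<open>x \<in> S\<close> d_mem) auto
    also have "(1 - \<xi> / \<eta>) *\<^sub>R x + (\<xi> / \<eta>) *\<^sub>R (x + \<eta> *\<^sub>R d \<eta>) = x + \<xi> *\<^sub>R d \<eta>"
      using that by (simp add: algebra_simps)
    finally have "(v - d \<xi>) \<bullet> (x + \<xi> *\<^sub>R d \<eta> - x - \<xi> *\<^sub>R d \<xi>) \<le> 0"
      unfolding d_def by (rule closest_point_quotient_inner_le[OF S _ that(1)])
    then have "\<xi> * ((v - d \<xi>) \<bullet> (d \<eta> - d \<xi>)) \<le> 0" by (simp add: algebra_simps)
    then have "(v - d \<xi>) \<bullet> (d \<eta> - d \<xi>) \<le> 0" using that by (simp add: mult_le_0_iff)
    moreover have "r \<eta> = r \<xi> - 2 * ((v - d \<xi>) \<bullet> (d \<eta> - d \<xi>)) + (norm (d \<xi> - d \<eta>))\<^sup>2"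
      unfolding r_def power2_norm_eq_inner by (simp add: inner_simps inner_commute algebra_simps)
    ultimately show ?thesis by linarith
  qed
  define L where "L = (INF \<xi>\<in>{0<..}. r \<xi>)"
  have bdd: "bdd_below (r ` {0<..})" by (intro bdd_belowI[of _ 0]) (auto simp: r_def)
  have L_le: "L \<le> r \<xi>" if "\<xi> > 0" for \<xi> using that bdd by (auto simp: L_def intro: cINF_lower)
  have "cauchy_filter (filtermap d (at_right 0))"
    unfolding cauchy_filter_metric_filtermap
  proof (intro allI impI)
    fix e :: real assume "e > 0"
    then have "L < L + e\<^sup>2" by simp
    \<comment> \<open>Below \<open>\<eta>0\<close> all values of \<open>r\<close> lie within
      \<open>e\<^sup>2\<close> of the infimum, so \<open>dist_le\<close> keeps the quotients within
      \<open>e\<close> of each other.\<close>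
    then obtain \<eta>0 where \<eta>0: "\<eta>0 > 0" "r \<eta>0 < L + e\<^sup>2"
      unfolding L_def by (subst (asm) cINF_less_iff) (use bdd in auto)
    have close: "dist (d \<xi>) (d \<eta>) < e" if "0 < \<xi>" "\<xi> \<le> \<eta>" "\<eta> \<le> \<eta>0" for \<xi> \<eta>
    proof -
      have "r \<eta> \<le> r \<eta>0"
        using dist_le[of \<eta> \<eta>0] that zero_le_power2[of "norm (d \<eta> - d \<eta>0)"] by linarith
      then have "(norm (d \<xi> - d \<eta>))\<^sup>2 < e\<^sup>2"
        using dist_le[of \<xi> \<eta>] L_le[of \<xi>] that \<eta>0(2) by linarith
      then show ?thesis using \<open>e > 0\<close> by (simp add: dist_norm power2_less_imp_less)
    qed
    show "\<exists>Q. eventually Q (at_right 0) \<and> (\<forall>\<xi> \<eta>. Q \<xi> \<and> Q \<eta> \<longrightarrow> dist (d \<xi>) (d \<eta>) < e)"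
    proof (intro exI[of _ "\<lambda>\<xi>. 0 < \<xi> \<and> \<xi> < \<eta>0"] conjI allI impI)
      show "\<forall>\<^sub>F \<xi> in at_right 0. 0 < \<xi> \<and> \<xi> < \<eta>0"
        using \<eta>0(1) by (auto simp: eventually_at_right_field)
    next
      fix \<xi> \<eta> assume "(0 < \<xi> \<and> \<xi> < \<eta>0) \<and> 0 < \<eta> \<and> \<eta> < \<eta>0"
      then show "dist (d \<xi>) (d \<eta>) < e"
        using close[of \<xi> \<eta>] close[of \<eta> \<xi>] by (cases "\<xi> \<le> \<eta>") (auto simp: dist_commute)
    qed
  qed
  then obtain p where "filterlim d (nhds p) (at_right 0)"
    using complete_UNIV[where 'a = 'v] complete_uniform[where S = "UNIV :: 'v set"]
    by (force simp: filterlim_def filtermap_bot_iff)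
  \<comment> \<open>Existence of a limit is what makes the \<open>Lim\<close> in the definition of
    \<open>proj_dir\<close> the actual limit.\<close>
  then show ?thesis
    unfolding proj_dir_def d_def by (simp add: tendsto_Lim)
qed

text \<open>As \<open>\<xi>\<close> tends to 0 the term \<open>\<xi> *\<^sub>R d\<close> disappears
  from the obtuse-angle inequality: the removed part \<open>v - proj_dir S x v\<close> forms no
  acute angle with any \<open>z - x\<close>.\<close>

lemma proj_dir_inner_le:
  fixes S :: "'v::euclidean_space set"
  assumes S: "convex S" "closed S" and "x \<in> S" "z \<in> S"
  shows "(x - z) \<bullet> proj_dir S x v \<le> (x - z) \<bullet> v"
proof -
  define d where "d \<xi> = (closest_point S (x + \<xi> *\<^sub>R v) - x) /\<^sub>R \<xi>" for \<xi>
  have d: "(d \<longlongrightarrow> proj_dir S x v) (at_right 0)"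
    using proj_dir_tendsto[OF S \<open>x \<in> S\<close>] by (simp add: d_def[abs_def])
  have "((\<lambda>\<xi>. (v - d \<xi>) \<bullet> (z - x - \<xi> *\<^sub>R d \<xi>)) \<longlongrightarrow>
      (v - proj_dir S x v) \<bullet> (z - x - 0 *\<^sub>R proj_dir S x v)) (at_right 0)"
    by (intro tendsto_intros d)
  moreover have "\<forall>\<^sub>F \<xi> in at_right 0. (v - d \<xi>) \<bullet> (z - x - \<xi> *\<^sub>R d \<xi>) \<le> 0"
    using closest_point_quotient_inner_le[OF S \<open>z \<in> S\<close>]
    by (auto simp: d_def eventually_at_right_field intro: exI[of _ 1])
  ultimately have "(v - proj_dir S x v) \<bullet> (z - x - 0 *\<^sub>R proj_dir S x v) \<le> 0"
    by (rule tendsto_upperbound) simp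
  then show ?thesis by (simp add: inner_simps inner_commute)
qed

section \<open>The nonnegative orthant, the 1-norm and sign vectors\<close>

lemma nonneg_orthant_iff: "v \<in> nonneg_orthant \<longleftrightarrow> (\<forall>k. 0 \<le> v $ k)" for v :: "real^'k::finite"
  by (simp add: nonneg_orthant_def less_eq_vec_def)

lemma convex_nonneg_orthant: "convex (nonneg_orthant :: (real^'k::finite) set)"
  by (simp add: convex_def nonneg_orthant_iff)

lemma closed_nonneg_orthant: "closed (nonneg_orthant :: (real^'k::finite) set)"
proof -
  have "closed {v :: real^'k. \<forall>k. 0 \<le> v $ k}"
    by (intro closed_Collect_all closed_Collect_le continuous_intros)
  then show ?thesis by (simp add: nonneg_orthant_iff[symmetric])
qed

text \<open>In each coordinate the positive part is the entry itself or 0. This evaluates the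
  pairing of the constraint integral with the final choice of \<open>w\<close>.\<close>

lemma inner_pos_part: "v \<bullet> pos_part v = (norm (pos_part v))\<^sup>2" for v :: "real^'k::finite"
  by (auto simp: power2_norm_eq_inner inner_vec_def pos_part_nth max_def intro!: sum.cong)

lemma pos_part_nonneg: "pos_part v \<in> nonneg_orthant" for v :: "real^'k::finite"
  by (simp add: nonneg_orthant_iff pos_part_nth)

lemma inner_orthant_nonpos:
  fixes v w :: "real^'k::finite"
  assumes "v \<in> nonneg_orthant" "w \<le> 0"
  shows "v \<bullet> w \<le> 0"
  unfolding inner_vec_def using assms
  by (intro sum_nonpos) (auto simp: nonneg_orthant_iff less_eq_vec_def mult_nonneg_nonpos)

lemma norm1_zero [simp]: "norm1 0 = 0"
  by (simp add: norm1_def)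

lemma norm1_minus_commute: "norm1 (v - w) = norm1 (w - v)"
  by (simp add: norm1_def abs_minus_commute)

lemma norm1_triangle: "norm1 (v + w) \<le> norm1 v + norm1 w"
  unfolding norm1_def sum.distrib[symmetric] by (intro sum_mono) auto

lemma norm1_nonneg: "norm1 v \<ge> 0"
  by (simp add: norm1_def sum_nonneg)

lemma norm_le_norm1: "norm v \<le> norm1 v"
  unfolding norm1_def by (rule norm_le_l1_cart)

lemma inner_sgn_vec: "v \<bullet> sgn_vec v = norm1 v"
  by (simp add: inner_vec_def sgn_vec_def norm1_def abs_sgn)

lemma inner_sgn_vec_le: "v \<bullet> sgn_vec w \<le> norm1 v"
  unfolding inner_vec_def norm1_def
proof (rule sum_mono)
  fix k
  show "v $ k \<bullet> sgn_vec w $ k \<le> \<bar>v $ k\<bar>" by (auto simp: sgn_vec_def sgn_if)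
qed

lemma sgn_vec_minus: "sgn_vec (v - w) = - sgn_vec (w - v)"
  by (simp add: vec_eq_iff sgn_vec_def flip: sgn_minus)

text \<open>Cauchy-Schwarz against the sign vector, whose entries have modulus at most 1. The
  resulting square root is the one that the trigger threshold divides by.\<close>

lemma norm1_le_norm:
  fixes v :: "real^'k::finite"
  shows "norm1 v \<le> sqrt (real CARD('k)) * norm v"
proof -
  have "(norm (sgn_vec v))\<^sup>2 = (\<Sum>k\<in>UNIV. (sgn (v $ k))\<^sup>2)"
    unfolding power2_norm_eq_inner inner_vec_def by (simp add: sgn_vec_def power2_eq_square)
  also have "\<dots> \<le> (\<Sum>k\<in>(UNIV::'k set). 1)" by (intro sum_mono) (simp add: sgn_if)
  finally have "norm (sgn_vec v) \<le> sqrt (real CARD('k))" by (simp add: real_le_rsqrt)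
  then have "norm v * norm (sgn_vec v) \<le> norm v * sqrt (real CARD('k))"
    by (rule mult_left_mono) simp
  then show ?thesis
    using norm_cauchy_schwarz[of v "sgn_vec v"] by (simp add: inner_sgn_vec mult.commute)
qed

section \<open>Edge sums over the communication graph\<close>

lemma adj_sym: "sym E \<Longrightarrow> adj E i j = adj E j i"
  by (auto simp: adj_def sym_def)

text \<open>
  Along a shortest path no edge is traversed twice, in either direction, so the path uses
  every undirected edge at most once; this gives the factor \<open>1/2\<close>.
\<close>

lemma pseudometric_le_edge_sum:
  fixes d :: "'a::finite \<Rightarrow> 'a \<Rightarrow> real"
  assumes "sym E" and "(i, j) \<in> E\<^sup>*"
    and d_refl: "\<And>k. d k k = 0" and d_sym: "\<And>k l. d k l = d l k"
    and d_triangle: "\<And>k l m. d k m \<le> d k l + d l m"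
  shows "d i j \<le> (\<Sum>k\<in>UNIV. \<Sum>l\<in>UNIV. adj E k l * d k l) / 2"
proof -
  have d_nonneg: "d k l \<ge> 0" for k l using d_triangle[of k k l] d_sym[of l k] d_refl[of k] by simp
  define n where "n = (LEAST n. (i, j) \<in> E ^^ n)"
  have "\<exists>n. (i, j) \<in> E ^^ n" using assms(2) by (simp add: rtrancl_power)
  then have "(i, j) \<in> E ^^ n" unfolding n_def by (rule LeastI_ex)
  then obtain p where p: "p 0 = i" "p n = j" "\<And>m. m < n \<Longrightarrow> (p m, p (Suc m)) \<in> E"
    unfolding relpow_fun_conv by blast
  have path: "(p a, p (a + m)) \<in> E ^^ m" if "a + m \<le> n" for a m
    unfolding relpow_fun_conv using that p(3) by (intro exI[of _ "\<lambda>l. p (a + l)"]) auto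
  have p_neq: "p a \<noteq> p b" if "a < b" "b \<le> n" for a b
  proof
    assume "p a = p b"
    \<comment> \<open>Cutting out the loop between positions \<open>a\<close> and \<open>b\<close>
      leaves a shorter walk from \<open>i\<close> to \<open>j\<close>.\<close>
    then have "(i, j) \<in> E ^^ (a + (n - b))"
      using path[of 0 a] path[of b "n - b"] that p(1,2) unfolding relpow_add by auto
    then have "n \<le> a + (n - b)" unfolding n_def by (rule Least_le)
    then show False using that by simp
  qed
  then have p_inj: "p a = p b \<longleftrightarrow> a = b" if "a \<le> n" "b \<le> n" for a b
    using that by (metis linorder_neqE_nat)
  \<comment> \<open>The path edges in forward and in reversed orientation. They are disjoint, and by
    symmetry of \<open>d\<close> each family carries the full path length, hence
    \<open>2 * d i j\<close> below.\<close>
  define F where "F = (\<lambda>m. (p m, p (Suc m))) ` {..<n}"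
  define F' where "F' = (\<lambda>m. (p (Suc m), p m)) ` {..<n}"
  have disj: "F \<inter> F' = {}" unfolding F_def F'_def by (auto simp: p_inj)
  have sub: "F \<union> F' \<subseteq> E" using p(3) \<open>sym E\<close> by (auto simp: F_def F'_def sym_def)
  have "d i (p m) \<le> (\<Sum>l<m. d (p l) (p (Suc l)))" if "m \<le> n" for m
    using that
  proof (induction m)
    case 0
    then show ?case by (simp add: p(1) d_refl)
  next
    case (Suc m)
    then show ?case using d_triangle[of i "p (Suc m)" "p m"] by simp
  qed
  then have "d i j \<le> (\<Sum>l<n. d (p l) (p (Suc l)))" using p(2) by blast
  moreover have "(\<Sum>l<n. d (p l) (p (Suc l))) = (\<Sum>e\<in>F. d (fst e) (snd e))"
    unfolding F_def by (subst sum.reindex) (auto simp: inj_on_def p_inj)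
  moreover have "(\<Sum>l<n. d (p l) (p (Suc l))) = (\<Sum>e\<in>F'. d (fst e) (snd e))"
    unfolding F'_def by (subst sum.reindex) (auto simp: inj_on_def p_inj d_sym)
  ultimately have "2 * d i j \<le> (\<Sum>e\<in>F \<union> F'. d (fst e) (snd e))"
    by (subst sum.union_disjoint[OF _ _ disj]) (auto simp: F_def F'_def)
  also have "\<dots> \<le> (\<Sum>e\<in>E. d (fst e) (snd e))"
    using sub d_nonneg by (intro sum_mono2) auto
  also have "\<dots> = (\<Sum>e\<in>UNIV. adj E (fst e) (snd e) * d (fst e) (snd e))"
    by (rule sum.mono_neutral_cong_left) (auto simp: adj_def)
  also have "\<dots> = (\<Sum>k\<in>UNIV. \<Sum>l\<in>UNIV. adj E k l * d k l)"
    by (simp add: sum.cartesian_product case_prod_unfold)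
  finally show ?thesis by simp
qed

section \<open>Event times and broadcast errors\<close>

text \<open>After a broadcast the error must grow from 0 to the threshold, and uniform continuity
  makes this take at least a fixed time \<open>\<delta>\<close>. The bound linear in
  \<open>l\<close> excludes accumulation of instants.\<close>

lemma event_times_unbounded:
  fixes \<mu> :: "'a::finite \<Rightarrow> real \<Rightarrow> real^'q::finite"
  assumes ev: "event_triggered E K\<mu> \<sigma> \<iota> T \<mu> tev \<mu>h"
    and pos: "\<sigma> > 0" "\<iota> > 0" "K\<mu> > 0"
    and cont: "uniformly_continuous_on {0..T} (\<mu> i)"
  obtains \<delta> where "\<delta> > 0" "\<And>l. ereal (real l * \<delta>) \<le> tev i l"
proof -
  \<comment> \<open>The decaying part of the threshold at its smallest, at the end time
    \<open>T\<close>; the neighbour part is merely nonnegative.\<close>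
  define c where "c = \<sigma> * exp (- \<iota> * T) / (3 * (real CARD('a))\<^sup>2 * K\<mu> * sqrt (real CARD('q)))"
  have "c > 0" using pos by (simp add: c_def)
  then obtain \<delta> where "\<delta> > 0" and \<delta>: "\<And>s t. s \<in> {0..T} \<Longrightarrow> t \<in> {0..T} \<Longrightarrow> dist t s < \<delta> \<Longrightarrow>
      dist (\<mu> i t) (\<mu> i s) < c"
    using cont unfolding uniformly_continuous_on_def by meson
  have "ereal (real l * \<delta>) \<le> tev i l" for l
  proof (induction l)
    case 0
    then show ?case using ev by (simp add: event_triggered_def zero_ereal_def)
  next
    case (Suc l)
    show ?case
    proof (cases "tev i l")
      case (real s)
      have s: "real l * \<delta> \<le> s" using Suc real by simp
      have "0 \<le> real l * \<delta>" using \<open>\<delta> > 0\<close> by simp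
      then have "s \<ge> 0" using s by linarith
      have "ereal (s + \<delta>) \<le> tev i (Suc l)"
      proof -
        have "s + \<delta> \<le> t" if "s < t" "t \<le> T" and trig: "norm (\<mu> i s - \<mu> i t)
            \<ge> 1 / (6 * real CARD('a) * sqrt (real CARD('q))) *
                (\<Sum>j\<in>UNIV. adj E i j * norm1 (\<mu> i s - \<mu>h j t))
              + \<sigma> * exp (- \<iota> * t) / (3 * (real CARD('a))\<^sup>2 * K\<mu> * sqrt (real CARD('q)))" for t
        proof -
          have "c \<le> \<sigma> * exp (- \<iota> * t) / (3 * (real CARD('a))\<^sup>2 * K\<mu> * sqrt (real CARD('q)))"
            unfolding c_def using pos that
            by (intro divide_right_mono mult_left_mono) auto
          moreover have "0 \<le> 1 / (6 * real CARD('a) * sqrt (real CARD('q))) *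
                (\<Sum>j\<in>UNIV. adj E i j * norm1 (\<mu> i s - \<mu>h j t))"
            by (intro mult_nonneg_nonneg sum_nonneg) (auto simp: adj_def norm1_nonneg)
          ultimately have "c \<le> dist (\<mu> i t) (\<mu> i s)"
            using trig by (simp add: dist_norm norm_minus_commute)
          then have "\<not> dist t s < \<delta>" using \<delta>[of s t] that \<open>s \<ge> 0\<close> by force
          then show ?thesis using that by (simp add: dist_real_def)
        qed
        then show ?thesis
          using ev real unfolding event_triggered_def by (auto intro!: Inf_greatest)
      qed
      moreover have "real (Suc l) * \<delta> \<le> s + \<delta>" using s by (simp add: algebra_simps)
      ultimately show ?thesis by (meson ereal_less_eq(3) order_trans)
    next
      case PInf
      \<comment> \<open>No real time exceeds \<open>\<infinity>\<close>, so the trigger set is empty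
        and its infimum is \<open>\<infinity>\<close> again.\<close>
      then have "tev i (Suc l) = \<infinity>" using ev by (simp add: event_triggered_def top_ereal_def)
      then show ?thesis by simp
    next
      case MInf
      then show ?thesis using Suc by simp
    qed
  qed
  then show thesis by (rule that[OF \<open>\<delta> > 0\<close>])
qed

text \<open>At a broadcast instant the error is 0. Later, a violated bound would have placed the
  next broadcast at or before \<open>t\<close>. A last broadcast up to \<open>t\<close> exists
  because the instants do not accumulate.\<close>

lemma broadcast_error_le:
  fixes \<mu> :: "'a::finite \<Rightarrow> real \<Rightarrow> real^'q::finite"
  assumes ev: "event_triggered E K\<mu> \<sigma> \<iota> T \<mu> tev \<mu>h"
    and pos: "\<sigma> > 0" "\<iota> > 0" "K\<mu> > 0"
    and cont: "uniformly_continuous_on {0..T} (\<mu> i)"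
    and t: "t \<in> {0..T}"
  shows "norm (\<mu>h i t - \<mu> i t) \<le> 1 / (6 * real CARD('a) * sqrt (real CARD('q))) *
                (\<Sum>j\<in>UNIV. adj E i j * norm1 (\<mu>h i t - \<mu>h j t))
              + \<sigma> * exp (- \<iota> * t) / (3 * (real CARD('a))\<^sup>2 * K\<mu> * sqrt (real CARD('q)))"
    (is "_ \<le> ?R (\<mu>h i t)")
proof -
  obtain \<delta> where "\<delta> > 0" and \<delta>: "\<And>l. ereal (real l * \<delta>) \<le> tev i l"
    using event_times_unbounded[OF ev pos cont] by blast
  obtain n where "t < real n * \<delta>" using \<open>\<delta> > 0\<close> reals_Archimedean3 by blast
  then have "ereal t < tev i n" using \<delta>[of n] by (meson ereal_less_eq(3) less_ereal.simps(1) less_le_trans)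
  \<comment> \<open>The first instant after \<open>t\<close>. Its index is positive because
    \<open>tev i 0 = 0\<close>, and its predecessor is the last broadcast up to
    \<open>t\<close>.\<close>
  define m where "m = (LEAST n. ereal t < tev i n)"
  have m: "ereal t < tev i m" unfolding m_def by (rule LeastI) fact
  have "tev i 0 = 0" using ev by (simp add: event_triggered_def)
  then have "m \<noteq> 0" using m t by (metis atLeastAtMost_iff ereal_less_eq(5) linorder_not_less)
  then obtain l where l: "m = Suc l" using not0_implies_Suc by blast
  have le: "tev i l \<le> ereal t" using not_less_Least[of l "\<lambda>n. ereal t < tev i n"] l by (simp add: m_def not_less)
  define s where "s = real_of_ereal (tev i l)"
  have s: "tev i l = ereal s"
  proof -
    have "tev i l \<noteq> \<infinity>" "tev i l \<noteq> -\<infinity>" using le \<delta>[of l] by auto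
    then show ?thesis unfolding s_def by (cases "tev i l") auto
  qed
  have h: "\<mu>h i t = \<mu> i s"
    using ev t le m unfolding event_triggered_def s_def l by blast
  have R: "0 \<le> ?R w" for w
    using pos by (intro add_nonneg_nonneg mult_nonneg_nonneg sum_nonneg) (auto simp: adj_def norm1_nonneg)
  show ?thesis
  proof (cases "s = t")
    case True
    then show ?thesis using h R[of "\<mu>h i t"] by simp
  next
    case False
    then have "s < t" using le s by simp
    show ?thesis
    proof (rule ccontr)
      assume "\<not> ?thesis"
      \<comment> \<open>The value held at \<open>t\<close> is still \<open>\<mu> i s\<close>, so the
        violated bound is the trigger condition at \<open>t\<close> itself.\<close>
      then have *: "?R (\<mu> i s) \<le> norm (\<mu> i s - \<mu> i t)" unfolding h by linarith
      have "tev i (Suc l) \<le> ereal t"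
        using ev * \<open>s < t\<close> t unfolding event_triggered_def
        by (auto simp: s intro!: Inf_lower)
      then show False using m l by simp
    qed
  qed
qed

section \<open>The consensus term\<close>

text \<open>
  The multipliers disagree only at the cost of the consensus term: \<open>\<Sum>\<^sub>i m\<^sub>i \<bullet> G\<^sub>i\<close> would be
  nonpositive for equal \<open>m\<^sub>i\<close>, and its excess is at most \<open>N Kg\<close> times half the edge sum of the
  disagreements.
\<close>

lemma multiplier_disagreement_bound:
  fixes m G :: "'a::finite \<Rightarrow> real^'q::finite"
  assumes E: "sym E" "\<And>i j. (i, j) \<in> E\<^sup>*"
    and G: "\<And>i. norm (G i) \<le> Kg" "(\<Sum>i\<in>UNIV. G i) \<le> 0"
    and m: "\<And>i. m i \<in> nonneg_orthant"
  shows "(\<Sum>i\<in>UNIV. m i \<bullet> G i)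
    \<le> real CARD('a) * Kg * ((\<Sum>i\<in>UNIV. \<Sum>j\<in>UNIV. adj E i j * norm1 (m i - m j)) / 2)"
proof -
  let ?N = "real CARD('a)" and ?D = "(\<Sum>i\<in>UNIV. \<Sum>j\<in>UNIV. adj E i j * norm1 (m i - m j)) / 2"
  fix a :: 'a
  have D: "norm (m i - m a) \<le> ?D" for i
  proof -
    have "norm1 (m i - m a) \<le> ?D"
    proof (rule pseudometric_le_edge_sum[where d = "\<lambda>i j. norm1 (m i - m j)"])
      show "norm1 (m k - m p) \<le> norm1 (m k - m l) + norm1 (m l - m p)" for k l p
        using norm1_triangle[of "m k - m l" "m l - m p"] by simp
    qed (auto intro: E norm1_minus_commute)
    then show ?thesis using norm_le_norm1[of "m i - m a"] by linarith
  qed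
  have "(\<Sum>i\<in>UNIV. m i \<bullet> G i) = (\<Sum>i\<in>UNIV. (m i - m a) \<bullet> G i) + m a \<bullet> (\<Sum>i\<in>UNIV. G i)"
    by (simp add: inner_diff_left inner_sum_right flip: sum.distrib)
  also have "\<dots> \<le> (\<Sum>i\<in>UNIV. (m i - m a) \<bullet> G i)"
    using inner_orthant_nonpos[OF m[of a] G(2)] by simp
  also have "\<dots> \<le> (\<Sum>i\<in>(UNIV::'a set). Kg * ?D)"
  proof (rule sum_mono)
    fix i
    have "(m i - m a) \<bullet> G i \<le> norm (m i - m a) * norm (G i)" by (rule norm_cauchy_schwarz)
    also have "\<dots> \<le> ?D * Kg"
      using D[of i] G(1)[of i] norm_ge_zero[of "m i - m a"] by (intro mult_mono) (linarith | simp)+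
    finally show "(m i - m a) \<bullet> G i \<le> Kg * ?D" by (simp add: mult.commute)
  qed
  also have "\<dots> = ?N * Kg * ?D" by simp
  finally show ?thesis .
qed

text \<open>Let \<open>S\<close> be the edge sum of the broadcast disagreements and \<open>R\<close>
  that of the errors. The first sum is at most \<open>K\<mu> * (S + 2 * R) / 2\<close>, and the sign
  term subtracts at least \<open>2 * K\<mu> * (S / 2 - R)\<close>. This leaves
  \<open>3 * K\<mu> * R - K\<mu> * S / 2\<close>, which the constants 6 and 3 of the trigger bring
  down to \<open>s\<close>.\<close>

lemma consensus_term_bound:
  fixes m mh G :: "'a::finite \<Rightarrow> real^'q::finite"
  assumes E: "sym E" "\<And>i j. (i, j) \<in> E\<^sup>*"
    and G: "\<And>i. norm (G i) \<le> Kg" "(\<Sum>i\<in>UNIV. G i) \<le> 0"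
    and m: "\<And>i. m i \<in> nonneg_orthant"
    and K\<mu>: "K\<mu> > 0" "K\<mu> \<ge> real CARD('a) * Kg"
    and err: "\<And>i. norm (mh i - m i) \<le> 1 / (6 * real CARD('a) * sqrt (real CARD('q))) *
          (\<Sum>j\<in>UNIV. adj E i j * norm1 (mh i - mh j))
        + s / (3 * (real CARD('a))\<^sup>2 * K\<mu> * sqrt (real CARD('q)))"
  shows "(\<Sum>i\<in>UNIV. m i \<bullet> G i)
    - 2 * K\<mu> * (\<Sum>i\<in>UNIV. (m i - w) \<bullet> (\<Sum>j\<in>UNIV. adj E i j *\<^sub>R sgn_vec (mh i - mh j))) \<le> s"
proof -
  let ?N = "real CARD('a)" and ?q = "real CARD('q)"
  define e where "e i = mh i - m i" for i
  define S where "S = (\<Sum>i\<in>UNIV. \<Sum>j\<in>UNIV. adj E i j * norm1 (mh i - mh j))"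
  define R where "R = (\<Sum>i\<in>UNIV. \<Sum>j\<in>UNIV. adj E i j * norm1 (e i))"
  define Z where "Z v = (\<Sum>i\<in>UNIV. v i \<bullet> (\<Sum>j\<in>UNIV. adj E i j *\<^sub>R sgn_vec (mh i - mh j)))"
    for v :: "'a \<Rightarrow> real^'q"
  note adj_commute = adj_sym[OF E(1)]
  have adj: "0 \<le> adj E i j" "adj E i j \<le> 1" for i j by (auto simp: adj_def)
  have Z_eq: "Z v = (\<Sum>i\<in>UNIV. \<Sum>j\<in>UNIV. adj E i j * (v i \<bullet> sgn_vec (mh i - mh j)))" for v
    by (simp add: Z_def inner_sum_right)
  \<comment> \<open>Exchanging the two agents preserves the weight and reverses the sign vector;
    averaging both forms gives \<open>Z_half\<close>.\<close>
  have Z_swap: "Z v = - (\<Sum>i\<in>UNIV. \<Sum>j\<in>UNIV. adj E i j * (v j \<bullet> sgn_vec (mh i - mh j)))" for v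
  proof -
    have "Z v = (\<Sum>i\<in>UNIV. \<Sum>j\<in>UNIV. adj E j i * (v j \<bullet> sgn_vec (mh j - mh i)))"
      unfolding Z_eq by (rule sum.swap)
    also have "\<dots> = (\<Sum>i\<in>UNIV. \<Sum>j\<in>UNIV. - (adj E i j * (v j \<bullet> sgn_vec (mh i - mh j))))"
    proof (intro sum.cong refl)
      fix i j
      show "adj E j i * (v j \<bullet> sgn_vec (mh j - mh i)) = - (adj E i j * (v j \<bullet> sgn_vec (mh i - mh j)))"
        using adj_commute[of i j] sgn_vec_minus[of "mh j" "mh i"] by simp
    qed
    finally show ?thesis by (simp only: sum_negf)
  qed
  have Z_half: "2 * Z v = (\<Sum>i\<in>UNIV. \<Sum>j\<in>UNIV. adj E i j * ((v i - v j) \<bullet> sgn_vec (mh i - mh j)))" for v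
  proof -
    have "2 * Z v = Z v + Z v" by simp
    also have "\<dots> = (\<Sum>i\<in>UNIV. \<Sum>j\<in>UNIV. adj E i j * (v i \<bullet> sgn_vec (mh i - mh j)))
        - (\<Sum>i\<in>UNIV. \<Sum>j\<in>UNIV. adj E i j * (v j \<bullet> sgn_vec (mh i - mh j)))"
      using Z_eq[of v] Z_swap[of v] by linarith
    finally show ?thesis by (simp add: inner_diff_left algebra_simps flip: sum_subtractf)
  qed
  \<comment> \<open>\<open>Z\<close> depends only on differences between agents, so the common shift
    \<open>w\<close> drops out.\<close>
  have Z_w: "Z (\<lambda>i. m i - w) = Z m"
    using Z_half[of "\<lambda>i. m i - w"] Z_half[of m] by simp
  have Z_mh: "2 * Z mh = S" by (simp add: Z_half S_def inner_sgn_vec)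
  have Z_e: "Z e \<le> R"
    unfolding Z_eq R_def by (intro sum_mono mult_left_mono inner_sgn_vec_le adj)
  have "Z m = Z mh - Z e"
    unfolding Z_eq by (simp add: e_def inner_diff_left algebra_simps flip: sum_subtractf)
  then have Z_m: "Z m \<ge> S / 2 - R" using Z_mh Z_e by linarith
  have disagree: "(\<Sum>i\<in>UNIV. \<Sum>j\<in>UNIV. adj E i j * norm1 (m i - m j)) \<le> S + 2 * R"
  proof -
    have "(\<Sum>i\<in>UNIV. \<Sum>j\<in>UNIV. adj E i j * norm1 (m i - m j))
        \<le> (\<Sum>i\<in>UNIV. \<Sum>j\<in>UNIV. adj E i j * norm1 (mh i - mh j)
            + adj E i j * norm1 (e i) + adj E i j * norm1 (e j))"
    proof (intro sum_mono)
      fix i j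
      have "m i - m j = (mh i - mh j) + ((e j - 0) + (0 - e i))" by (simp add: e_def)
      then have "norm1 (m i - m j) \<le> norm1 (mh i - mh j) + (norm1 (e j - 0) + norm1 (0 - e i))"
        using norm1_triangle[of "mh i - mh j" "(e j - 0) + (0 - e i)"]
          norm1_triangle[of "e j - 0" "0 - e i"] by simp
      then have "norm1 (m i - m j) \<le> norm1 (mh i - mh j) + norm1 (e i) + norm1 (e j)"
        using norm1_minus_commute[of 0 "e i"] by simp
      from mult_left_mono[OF this adj(1)[of i j]]
      show "adj E i j * norm1 (m i - m j) \<le> adj E i j * norm1 (mh i - mh j)
            + adj E i j * norm1 (e i) + adj E i j * norm1 (e j)" by (simp add: algebra_simps)
    qed
    also have "\<dots> = S + R + (\<Sum>i\<in>UNIV. \<Sum>j\<in>UNIV. adj E i j * norm1 (e j))"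
      by (simp add: S_def R_def sum.distrib)
    also have "(\<Sum>i\<in>UNIV. \<Sum>j\<in>UNIV. adj E i j * norm1 (e j)) = R"
      unfolding R_def by (subst sum.swap) (intro sum.cong refl arg_cong2[where f = "(*)"] adj_commute)
    finally show ?thesis by simp
  qed
  have "?N * Kg * ((\<Sum>i\<in>UNIV. \<Sum>j\<in>UNIV. adj E i j * norm1 (m i - m j)) / 2) \<le> K\<mu> * ((S + 2 * R) / 2)"
    using K\<mu> disagree
    by (intro mult_mono) (auto intro!: sum_nonneg mult_nonneg_nonneg adj norm1_nonneg)
  then have first: "(\<Sum>i\<in>UNIV. m i \<bullet> G i) \<le> K\<mu> * ((S + 2 * R) / 2)"
    using multiplier_disagreement_bound[of E G Kg m, OF E G m] by linarith
  \<comment> \<open>Each error is counted once per neighbour, so at most \<open>?N\<close> times.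
    This factor and \<open>sqrt ?q\<close> from the norm comparison cancel against the threshold;
    summing over the agents uses up the remaining \<open>1 / ?N\<close>.\<close>
  have "R \<le> (\<Sum>i\<in>UNIV. ?N * norm1 (e i))"
    unfolding R_def
  proof (rule sum_mono)
    fix i
    have "(\<Sum>j\<in>UNIV. adj E i j * norm1 (e i)) \<le> (\<Sum>j\<in>(UNIV::'a set). 1 * norm1 (e i))"
      by (intro sum_mono mult_right_mono adj norm1_nonneg)
    then show "(\<Sum>j\<in>UNIV. adj E i j * norm1 (e i)) \<le> ?N * norm1 (e i)" by simp
  qed
  also have "\<dots> \<le> (\<Sum>i\<in>UNIV. (\<Sum>j\<in>UNIV. adj E i j * norm1 (mh i - mh j)) / 6 + s / (3 * ?N * K\<mu>))"
  proof (rule sum_mono)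
    fix i
    let ?A = "\<Sum>j\<in>UNIV. adj E i j * norm1 (mh i - mh j)"
    have "norm1 (e i) \<le> sqrt ?q * norm (e i)" by (rule norm1_le_norm)
    also have "\<dots> \<le> sqrt ?q * (1 / (6 * ?N * sqrt ?q) * ?A + s / (3 * ?N\<^sup>2 * K\<mu> * sqrt ?q))"
      unfolding e_def by (rule mult_left_mono[OF err]) simp
    also have "\<dots> = ?A / (6 * ?N) + s / (3 * ?N\<^sup>2 * K\<mu>)"
      using K\<mu>(1) by (simp add: field_simps)
    finally have "?N * norm1 (e i) \<le> ?N * (?A / (6 * ?N) + s / (3 * ?N\<^sup>2 * K\<mu>))"
      by (rule mult_left_mono) simp
    also have "\<dots> = ?A / 6 + s / (3 * ?N * K\<mu>)"
      using K\<mu>(1) by (simp add: field_simps power2_eq_square)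
    finally show "?N * norm1 (e i) \<le> ?A / 6 + s / (3 * ?N * K\<mu>)" .
  qed
  also have "\<dots> = S / 6 + s / (3 * K\<mu>)"
    using K\<mu>(1) by (simp add: S_def sum.distrib sum_divide_distrib)
  finally have "3 * K\<mu> * R \<le> 3 * K\<mu> * (S / 6 + s / (3 * K\<mu>))"
    using K\<mu>(1) by (intro mult_left_mono) auto
  also have "\<dots> = K\<mu> * S / 2 + s" using K\<mu>(1) by (simp add: field_simps)
  finally have R: "3 * K\<mu> * R \<le> K\<mu> * S / 2 + s" .
  have "2 * K\<mu> * Z m \<ge> 2 * K\<mu> * (S / 2 - R)"
    using K\<mu>(1) Z_m by (intro mult_left_mono) auto
  then have "(\<Sum>i\<in>UNIV. m i \<bullet> G i) - 2 * K\<mu> * Z m \<le> s"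
    using first R by (simp add: algebra_simps)
  then show ?thesis using Z_w by (simp add: Z_def)
qed

section \<open>Tools for the Lyapunov derivative\<close>

text \<open>The subgradient inequalities add up with weights \<open>m $ k\<close>, whose
  nonnegativity preserves their direction.\<close>

lemma lagr_subdiff_inner_le:
  fixes \<gamma> :: "'v::euclidean_space \<Rightarrow> real^'q::finite"
  assumes "h \<in> lagr_subdiff V S \<phi> \<gamma> x m" "m \<in> nonneg_orthant" "z \<in> S"
  shows "h \<bullet> (z - x) \<le> \<phi> z - \<phi> x + (m \<bullet> \<gamma> z - m \<bullet> \<gamma> x)"
proof -
  obtain s r where h: "h = s + (\<Sum>k\<in>UNIV. (m $ k) *\<^sub>R r k)" and s: "s \<in> subdiff V S \<phi> x"
    and r: "\<And>k. r k \<in> subdiff V S (\<lambda>z. \<gamma> z $ k) x"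
    using assms(1) unfolding lagr_subdiff_def by blast
  have "h \<bullet> (z - x) = s \<bullet> (z - x) + (\<Sum>k\<in>UNIV. m $ k * (r k \<bullet> (z - x)))"
    by (simp add: h inner_add_left inner_sum_left)
  also have "\<dots> \<le> (\<phi> z - \<phi> x) + (\<Sum>k\<in>UNIV. m $ k * (\<gamma> z $ k - \<gamma> x $ k))"
  proof (intro add_mono sum_mono mult_left_mono)
    show "s \<bullet> (z - x) \<le> \<phi> z - \<phi> x" using s \<open>z \<in> S\<close> by (auto simp: subdiff_def)
    show "r k \<bullet> (z - x) \<le> \<gamma> z $ k - \<gamma> x $ k" for k
      using r[of k] \<open>z \<in> S\<close> by (auto simp: subdiff_def)
    show "0 \<le> m $ k" for k using assms(2) by (simp add: nonneg_orthant_iff)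
  qed
  also have "(\<Sum>k\<in>UNIV. m $ k * (\<gamma> z $ k - \<gamma> x $ k)) = m \<bullet> \<gamma> z - m \<bullet> \<gamma> x"
    by (simp add: inner_vec_def right_diff_distrib sum_subtractf)
  finally show ?thesis .
qed

lemma coord_id_mult: "coord_id I *v w = (\<chi> k. if k \<in> I then w $ k else 0)"
  by (auto simp: coord_id_def matrix_vector_mult_def vec_eq_iff if_distrib[of "\<lambda>c. c * _"] sum.If_cases
      intro: sum.neutral cong: if_cong)

text \<open>\<open>coord_id I\<close> is the orthogonal projection onto
  \<open>coord_space I\<close>. In the padded setting it takes the place of the identity in the
  closed-loop output velocity.\<close>

lemma inner_coord_id:
  assumes "v \<in> coord_space I"
  shows "v \<bullet> (coord_id I *v w) = v \<bullet> w"
  using assms by (auto simp: coord_id_mult inner_vec_def coord_space_def intro!: sum.cong)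

lemma has_vector_derivative_half_sq_dist:
  fixes h :: "real \<Rightarrow> 'v::real_inner"
  assumes "(h has_vector_derivative D) (at t within S)"
  shows "((\<lambda>t. (norm (h t - c))\<^sup>2 / 2) has_vector_derivative (h t - c) \<bullet> D) (at t within S)"
proof -
  have "((\<lambda>t. (h t - c) \<bullet> (h t - c) / 2) has_derivative (\<lambda>s. s *\<^sub>R ((h t - c) \<bullet> D))) (at t within S)"
    using assms unfolding has_vector_derivative_def
    by (auto intro!: derivative_eq_intros simp: inner_commute field_simps)
  then show ?thesis by (simp add: has_vector_derivative_def power2_norm_eq_inner)
qed

text \<open>Replacing \<open>h\<close> by \<open>k\<close> on the exceptional null set keeps the
  integral and makes the inequality hold everywhere.\<close>

lemma has_integral_le_AE:
  fixes h k :: "real \<Rightarrow> real"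
  assumes "(h has_integral I) S" "(k has_integral J) S" "AE t in lebesgue. t \<in> S \<longrightarrow> h t \<le> k t"
  shows "I \<le> J"
proof -
  obtain N where N: "negligible N" "\<And>t. t \<notin> N \<Longrightarrow> t \<in> S \<Longrightarrow> h t \<le> k t"
    using assms(3) by (auto elim: AE_lebesgue_imp_negligible)
  have "((\<lambda>t. if t \<in> N then k t else h t) has_integral I) S"
    by (rule has_integral_spike[OF N(1) _ assms(1)]) simp
  then show ?thesis using assms(2) by (rule has_integral_le) (simp add: N(2))
qed

lemma integral_exp_decay_le:
  fixes \<iota> T :: real
  assumes "T \<ge> 0" "\<iota> > 0"
  obtains J where "((\<lambda>t. exp (- \<iota> * t)) has_integral J) {0..T}" "J \<le> 1 / \<iota>"
proof -
  have "((\<lambda>t. exp (- \<iota> * t)) has_integral (- exp (- \<iota> * T) / \<iota> - - exp (- \<iota> * 0) / \<iota>)) {0..T}"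
    using assms
    by (intro fundamental_theorem_of_calculus)
      (auto intro!: derivative_eq_intros simp flip: has_real_derivative_iff_has_vector_derivative)
  then show thesis by (rule that) (use assms in \<open>simp add: divide_simps\<close>)
qed

section \<open>The Lyapunov estimate along the closed loop\<close>

theorem theorem4:
  fixes E :: "('a::finite \<times> 'a) set"
    and X :: "'a \<Rightarrow> 'n::finite set"
    and U :: "'a \<Rightarrow> 'm::finite set"
    and P :: "'a \<Rightarrow> 'p::finite set"
    and A :: "'a \<Rightarrow> real^'n^'n"
    and B :: "'a \<Rightarrow> real^'m^'n"
    and C :: "'a \<Rightarrow> real^'n^'p"
    and K\<alpha> :: "'a \<Rightarrow> real^'n^'m"
    and K\<beta> :: "'a \<Rightarrow> real^'p^'m"
    and Y :: "'a \<Rightarrow> (real^'p) set"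
    and f :: "'a \<Rightarrow> real \<Rightarrow> real^'p \<Rightarrow> real"
    and g :: "'a \<Rightarrow> real \<Rightarrow> real^'p \<Rightarrow> real^'q::finite"
    and H :: "'a \<Rightarrow> real \<Rightarrow> real^'p \<Rightarrow> real^'q \<Rightarrow> real^'p"
    and Kf Kg K\<mu> \<epsilon> \<sigma> \<iota> T :: real
    and ystar :: "real^'p^'a"
    and x :: "'a \<Rightarrow> real \<Rightarrow> real^'n"
    and u :: "'a \<Rightarrow> real \<Rightarrow> real^'m"
    and y :: "'a \<Rightarrow> real \<Rightarrow> real^'p"
    and \<mu> \<mu>h :: "'a \<Rightarrow> real \<Rightarrow> real^'q"
    and tev :: "'a \<Rightarrow> nat \<Rightarrow> ereal"
  assumes T: "T \<ge> 0"
    \<comment> \<open>system matrices of sizes \<open>n\<^sub>i \<times> n\<^sub>i\<close>, \<open>n\<^sub>i \<times> m\<^sub>i\<close>, \<open>p\<^sub>i \<times> n\<^sub>i\<close>\<close>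
    and sizes: "\<And>i. A i \<in> coord_mats (X i) (X i)" "\<And>i. B i \<in> coord_mats (X i) (U i)"
      "\<And>i. C i \<in> coord_mats (P i) (X i)"
    and graph: "sym E" "irrefl E" "\<And>i j. (i, j) \<in> E\<^sup>*"
    and Y: "\<And>i. Y i \<subseteq> coord_space (P i)" "\<And>i. convex (Y i)" "\<And>i. compact (Y i)"
    and convex_f: "\<And>i t. t \<in> {0..T} \<Longrightarrow> convex_on (Y i) (f i t)"
    and convex_g: "\<And>i t k. t \<in> {0..T} \<Longrightarrow> convex_on (Y i) (\<lambda>z. g i t z $ k)"
    and bounds: "Kf > 0" "Kg > 0"
      "\<And>i t z. t \<in> {0..T} \<Longrightarrow> z \<in> Y i \<Longrightarrow> \<bar>f i t z\<bar> \<le> Kf"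
      "\<And>i t z. t \<in> {0..T} \<Longrightarrow> z \<in> Y i \<Longrightarrow> norm (g i t z) \<le> Kg"
    and integrable: "\<And>i z. z \<in> Y i \<Longrightarrow> (\<lambda>t. f i t z) absolutely_integrable_on {0..T}"
      "\<And>i z. z \<in> Y i \<Longrightarrow> (\<lambda>t. g i t z) absolutely_integrable_on {0..T}"
      "\<And>i. (\<lambda>t. f i t (y i t)) absolutely_integrable_on {0..T}"
      "\<And>i. (\<lambda>t. g i t (y i t)) absolutely_integrable_on {0..T}"
    and feasible_nonempty: "feasible Y g T \<noteq> {}"
    and controllable: "\<And>i. controllable (X i) (U i) (A i) (B i)"
    and rank_CB: "\<And>i. rank (C i ** B i) = card (P i)"
    \<comment> \<open>feedback matrices\<close>
    and K\<alpha>: "\<And>i. K\<alpha> i \<in> coord_mats (U i) (X i)" "\<And>i. C i ** B i ** K\<alpha> i = C i ** A i"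
    and K\<beta>: "\<And>i. K\<beta> i \<in> coord_mats (U i) (P i)" "\<And>i. C i ** B i ** K\<beta> i = coord_id (P i)"
    \<comment> \<open>optimal solution and parameters\<close>
    and optimal: "is_arg_min (total_cost f T) (\<lambda>z. z \<in> feasible Y g T) ystar"
    and params: "\<epsilon> > 0" "\<sigma> > 0" "\<iota> > 0" "K\<mu> \<ge> real CARD('a) * Kg"
    \<comment> \<open>closed-loop trajectory\<close>
    and abs_cont: "\<And>i. absolutely_cont_on 0 T (x i)" "\<And>i. absolutely_cont_on 0 T (\<mu> i)"
    and ranges: "\<And>i t. t \<in> {0..T} \<Longrightarrow> x i t \<in> coord_space (X i)"
      "\<And>i t. t \<in> {0..T} \<Longrightarrow> y i t \<in> Y i"
      "\<And>i t. t \<in> {0..T} \<Longrightarrow> \<mu> i t \<in> nonneg_orthant"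
    and output_eq: "\<And>i t. t \<in> {0..T} \<Longrightarrow> y i t = C i *v x i t"
    and dynamics: "\<And>i. AE t in lebesgue. t \<in> {0..T} \<longrightarrow>
        (x i has_vector_derivative (A i *v x i t + B i *v u i t)) (at t within {0..T})"
    and subgradient: "\<And>i. AE t in lebesgue. t \<in> {0..T} \<longrightarrow>
        H i t (y i t) (\<mu> i t)
          \<in> lagr_subdiff (coord_space (P i)) (Y i) (f i t) (g i t) (y i t) (\<mu> i t)"
    and control: "\<And>i. AE t in lebesgue. t \<in> {0..T} \<longrightarrow>
        u i t = - (K\<alpha> i *v x i t)
          + K\<beta> i *v proj_dir (Y i) (y i t) (- \<epsilon> *\<^sub>R H i t (y i t) (\<mu> i t))"
    and multiplier: "\<And>i. AE t in lebesgue. t \<in> {0..T} \<longrightarrow>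
        (\<mu> i has_vector_derivative
          proj_dir nonneg_orthant (\<mu> i t)
            (\<epsilon> *\<^sub>R g i t (y i t)
              - (2 * \<epsilon> * K\<mu>) *\<^sub>R (\<Sum>j\<in>UNIV. adj E i j *\<^sub>R sgn_vec (\<mu>h i t - \<mu>h j t))))
        (at t within {0..T})"
    and multiplier0: "\<And>i. \<mu> i 0 = 0"
    and events: "event_triggered E K\<mu> \<sigma> \<iota> T \<mu> tev \<mu>h"
  shows "norm (pos_part (integral {0..T} (\<lambda>t. \<Sum>i\<in>UNIV. g i t (y i t))))
    \<le> sqrt (real CARD('a)) * norm ((\<chi> i. y i 0) - ystar) / \<epsilon>
      + sqrt (2 * real CARD('a) * \<sigma> / (\<epsilon> * \<iota>))
      + 2 * real CARD('a) * sqrt (Kf / \<epsilon>) * sqrt T"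
proof -
  let ?N = "real CARD('a)"
  define G where "G = integral {0..T} (\<lambda>t. \<Sum>i\<in>UNIV. g i t (y i t))"
  \<comment> \<open>The maximiser of
    \<open>\<epsilon> * (w \<bullet> G) - ?N * (norm w)\<^sup>2 / 2\<close> over the nonnegative
    orthant, which is the gain in the inequality \<open>main\<close>.\<close>
  define w where "w = (\<epsilon> / ?N) *\<^sub>R pos_part G"
  define \<Delta> where "\<Delta> = norm ((\<chi> i. y i 0) - ystar)"
  define D1 where "D1 i t = (y i t - ystar $ i) \<bullet> (C i *v (A i *v x i t + B i *v u i t))" for i t
  define D2 where "D2 i t = (\<mu> i t - w) \<bullet> proj_dir nonneg_orthant (\<mu> i t)
      (\<epsilon> *\<^sub>R g i t (y i t) - (2 * \<epsilon> * K\<mu>) *\<^sub>R (\<Sum>j\<in>UNIV. adj E i j *\<^sub>R sgn_vec (\<mu>h i t - \<mu>h j t)))"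
    for i t
  define V1 where "V1 i t = (norm (y i t - ystar $ i))\<^sup>2 / 2" for i t
  define V2 where "V2 i t = (norm (\<mu> i t - w))\<^sup>2 / 2" for i t
  have N: "?N > 0" by simp
  have K\<mu>: "K\<mu> > 0" using params(4) bounds(2) mult_pos_pos[OF N bounds(2)] by linarith
  have w: "w \<in> nonneg_orthant"
    using pos_part_nonneg[of G] params(1) by (simp add: w_def nonneg_orthant_iff)
  have "ystar \<in> feasible Y g T" using optimal by (simp add: is_arg_min_def)
  then have ystar: "\<And>i. ystar $ i \<in> Y i" "\<And>t. t \<in> {0..T} \<Longrightarrow> (\<Sum>i\<in>UNIV. g i t (ystar $ i)) \<le> 0"
    by (auto simp: feasible_def)
  have gy: "((\<lambda>t. \<Sum>i\<in>UNIV. g i t (y i t)) has_integral G) {0..T}"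
    unfolding G_def
    by (intro integrable_integral integrable_sum set_lebesgue_integral_eq_integral(1) integrable(4)) simp
  \<comment> \<open>Regularity is given for the state, so \<open>C i *v x i t\<close> is
    differentiated and the output is restored at the end points.\<close>
  have int1: "(D1 i has_integral (V1 i T - V1 i 0)) {0..T}" for i
  proof -
    have "bounded_linear (\<lambda>v. C i *v v)" by (rule matrix_vector_mul_bounded_linear)
    note ac = absolutely_cont_on_sq_dist[OF abs_cont(1)[of i] this, of "ystar $ i"]
    have "(D1 i has_integral ((norm (C i *v x i T - ystar $ i))\<^sup>2 / 2 - (norm (C i *v x i 0 - ystar $ i))\<^sup>2 / 2)) {0..T}"
    proof (rule fundamental_theorem_of_calculus_absolutely_cont[OF T ac])
      show "AE t in lebesgue. t \<in> {0..T} \<longrightarrow> ((\<lambda>t. (norm (C i *v x i t - ystar $ i))\<^sup>2 / 2)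
          has_vector_derivative D1 i t) (at t within {0..T})"
        using dynamics[of i]
      proof (rule AE_mp, intro AE_I2 impI)
        fix t assume t: "t \<in> {0..T}"
          and "t \<in> {0..T} \<longrightarrow>
            (x i has_vector_derivative A i *v x i t + B i *v u i t) (at t within {0..T})"
        then have "((\<lambda>t. C i *v x i t) has_vector_derivative C i *v (A i *v x i t + B i *v u i t))
            (at t within {0..T})"
          by (intro bounded_linear.has_vector_derivative[OF matrix_vector_mul_bounded_linear]) auto
        from has_vector_derivative_half_sq_dist[OF this, of "ystar $ i"]
        show "((\<lambda>t. (norm (C i *v x i t - ystar $ i))\<^sup>2 / 2) has_vector_derivative D1 i t) (at t within {0..T})"
          using output_eq[OF t, of i] by (simp add: D1_def)
      qed
    qed
    then show ?thesis using T output_eq[of T i] output_eq[of 0 i] by (simp add: V1_def)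
  qed
  have int2: "(D2 i has_integral (V2 i T - V2 i 0)) {0..T}" for i
    unfolding V2_def
  proof (rule fundamental_theorem_of_calculus_absolutely_cont[OF T
        absolutely_cont_on_sq_dist[OF abs_cont(2)[of i] bounded_linear_ident, of w]])
    show "AE t in lebesgue. t \<in> {0..T} \<longrightarrow>
        ((\<lambda>t. (norm (\<mu> i t - w))\<^sup>2 / 2) has_vector_derivative D2 i t) (at t within {0..T})"
      using multiplier[of i]
      by (rule AE_mp) (auto simp: D2_def intro!: AE_I2 has_vector_derivative_half_sq_dist)
  qed
  have int_V: "((\<lambda>t. \<Sum>i\<in>UNIV. D1 i t + D2 i t) has_integral
      (\<Sum>i\<in>UNIV. (V1 i T - V1 i 0) + (V2 i T - V2 i 0))) {0..T}"
    by (intro has_integral_sum has_integral_add int1 int2) simp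
  obtain J where J: "((\<lambda>t. exp (- \<iota> * t)) has_integral J) {0..T}" "J \<le> 1 / \<iota>"
    using integral_exp_decay_le[OF T params(3)] by blast
  have int_R: "((\<lambda>t. \<epsilon> * (2 * ?N * Kf + \<sigma> * exp (- \<iota> * t) - w \<bullet> (\<Sum>i\<in>UNIV. g i t (y i t))))
      has_integral \<epsilon> * (2 * ?N * Kf * T + \<sigma> * J - w \<bullet> G)) {0..T}"
  proof (intro has_integral_mult_right has_integral_diff has_integral_add J(1))
    show "((\<lambda>t. 2 * ?N * Kf) has_integral 2 * ?N * Kf * T) {0..T}"
      using has_integral_const_real[of "2 * ?N * Kf" 0 T] T by (simp add: mult.commute)
    show "((\<lambda>t. w \<bullet> (\<Sum>i\<in>UNIV. g i t (y i t))) has_integral w \<bullet> G) {0..T}"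
      using has_integral_linear[OF gy bounded_linear_inner_right[of w]] by (simp add: o_def)
  qed
  have D1_le: "D1 i t \<le> \<epsilon> * (2 * Kf + (\<mu> i t \<bullet> g i t (ystar $ i) - \<mu> i t \<bullet> g i t (y i t)))"
    if t: "t \<in> {0..T}"
      and H: "H i t (y i t) (\<mu> i t)
          \<in> lagr_subdiff (coord_space (P i)) (Y i) (f i t) (g i t) (y i t) (\<mu> i t)"
      and u: "u i t = - (K\<alpha> i *v x i t)
          + K\<beta> i *v proj_dir (Y i) (y i t) (- \<epsilon> *\<^sub>R H i t (y i t) (\<mu> i t))" for i t
  proof -
    let ?H = "H i t (y i t) (\<mu> i t)"
    let ?p = "proj_dir (Y i) (y i t) (- \<epsilon> *\<^sub>R ?H)"
    have yY: "y i t \<in> Y i" using ranges(2)[OF t] .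
    \<comment> \<open>The gain \<open>K\<alpha> i\<close> cancels the drift
      \<open>C i ** A i\<close>, and \<open>K\<beta> i\<close> turns the input channel into the
      identity on the outputs of agent \<open>i\<close>.\<close>
    have cl: "C i *v (A i *v x i t + B i *v u i t) = coord_id (P i) *v ?p"
    proof -
      have "C i *v (A i *v x i t + B i *v u i t)
          = (C i ** A i) *v x i t - (C i ** B i ** K\<alpha> i) *v x i t + (C i ** B i ** K\<beta> i) *v ?p"
        unfolding u
        by (simp add: matrix_vector_mul_assoc[symmetric] matrix_vector_right_distrib
            linear_neg[OF matrix_vector_mul_linear] algebra_simps del: scaleR_minus_left)
      then show ?thesis by (simp add: K\<alpha>(2) K\<beta>(2))
    qed
    have "y i t - ystar $ i \<in> coord_space (P i)"
      using subsetD[OF Y(1) yY] subsetD[OF Y(1) ystar(1)] by (simp add: coord_space_def)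
    then have "D1 i t = (y i t - ystar $ i) \<bullet> ?p" by (simp add: D1_def cl inner_coord_id)
    also have "\<dots> \<le> (y i t - ystar $ i) \<bullet> (- \<epsilon> *\<^sub>R ?H)"
      by (rule proj_dir_inner_le[OF Y(2) compact_imp_closed[OF Y(3)] yY ystar(1)])
    also have "\<dots> = \<epsilon> * (?H \<bullet> (ystar $ i - y i t))"
      by (simp add: inner_simps inner_commute algebra_simps)
    also have "\<dots> \<le> \<epsilon> * (2 * Kf + (\<mu> i t \<bullet> g i t (ystar $ i) - \<mu> i t \<bullet> g i t (y i t)))"
    proof (rule mult_left_mono)
      have "f i t (ystar $ i) - f i t (y i t) \<le> 2 * Kf"
        using bounds(3)[OF t ystar(1)[of i]] bounds(3)[OF t yY] by linarith
      then show "?H \<bullet> (ystar $ i - y i t) \<le> 2 * Kf + (\<mu> i t \<bullet> g i t (ystar $ i) - \<mu> i t \<bullet> g i t (y i t))"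
        using lagr_subdiff_inner_le[OF H ranges(3)[OF t] ystar(1)] by linarith
    qed (use params in simp)
    finally show ?thesis .
  qed
  have D2_le: "D2 i t \<le> \<epsilon> * (\<mu> i t \<bullet> g i t (y i t) - w \<bullet> g i t (y i t)
      - 2 * K\<mu> * ((\<mu> i t - w) \<bullet> (\<Sum>j\<in>UNIV. adj E i j *\<^sub>R sgn_vec (\<mu>h i t - \<mu>h j t))))"
    if t: "t \<in> {0..T}" for i t
    using proj_dir_inner_le[OF convex_nonneg_orthant closed_nonneg_orthant ranges(3)[OF t, of i] w,
        of "\<epsilon> *\<^sub>R g i t (y i t) - (2 * \<epsilon> * K\<mu>) *\<^sub>R (\<Sum>j\<in>UNIV. adj E i j *\<^sub>R sgn_vec (\<mu>h i t - \<mu>h j t))"]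
    unfolding D2_def[symmetric]
    by (simp add: inner_diff_right inner_diff_left[of _ _ "g i t (y i t)"] algebra_simps)
  have V_le: "(\<Sum>i\<in>UNIV. D1 i t + D2 i t)
      \<le> \<epsilon> * (2 * ?N * Kf + \<sigma> * exp (- \<iota> * t) - w \<bullet> (\<Sum>i\<in>UNIV. g i t (y i t)))"
    if t: "t \<in> {0..T}"
      and H: "\<And>i. H i t (y i t) (\<mu> i t)
          \<in> lagr_subdiff (coord_space (P i)) (Y i) (f i t) (g i t) (y i t) (\<mu> i t)"
      and u: "\<And>i. u i t = - (K\<alpha> i *v x i t)
          + K\<beta> i *v proj_dir (Y i) (y i t) (- \<epsilon> *\<^sub>R H i t (y i t) (\<mu> i t))" for t
  proof -
    let ?Z = "\<lambda>i. (\<mu> i t - w) \<bullet> (\<Sum>j\<in>UNIV. adj E i j *\<^sub>R sgn_vec (\<mu>h i t - \<mu>h j t))"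
    \<comment> \<open>Feasibility of \<open>ystar\<close> at time \<open>t\<close> supplies the
      nonpositive sum needed for the consensus bound, applied with
      \<open>s = \<sigma> * exp (- \<iota> * t)\<close>.\<close>
    have "(\<Sum>i\<in>UNIV. \<mu> i t \<bullet> g i t (ystar $ i)) - 2 * K\<mu> * (\<Sum>i\<in>UNIV. ?Z i) \<le> \<sigma> * exp (- \<iota> * t)"
      using graph(1,3) bounds(4)[OF t ystar(1)] ystar(2)[OF t] ranges(3)[OF t] K\<mu> params(4)
        broadcast_error_le[OF events params(2,3) K\<mu>
          absolutely_cont_on_imp_uniformly_continuous_on[OF abs_cont(2)] t]
      by (intro consensus_term_bound) auto
    \<comment> \<open>The terms \<open>\<mu> i t \<bullet> g i t (y i t)\<close> of the output part
      and the multiplier part cancel.\<close>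
    moreover have "(\<Sum>i\<in>UNIV. D1 i t + D2 i t) \<le> (\<Sum>i\<in>UNIV. \<epsilon> * (2 * Kf
        + \<mu> i t \<bullet> g i t (ystar $ i) - w \<bullet> g i t (y i t) - 2 * K\<mu> * ?Z i))"
    proof (rule sum_mono)
      fix i
      show "D1 i t + D2 i t \<le> \<epsilon> * (2 * Kf
        + \<mu> i t \<bullet> g i t (ystar $ i) - w \<bullet> g i t (y i t) - 2 * K\<mu> * ?Z i)"
        using D1_le[OF t H u, of i] D2_le[OF t, of i] by (simp add: algebra_simps)
    qed
    moreover have "(\<Sum>i\<in>UNIV. \<epsilon> * (2 * Kf
        + \<mu> i t \<bullet> g i t (ystar $ i) - w \<bullet> g i t (y i t) - 2 * K\<mu> * ?Z i))
        = \<epsilon> * (2 * ?N * Kf + ((\<Sum>i\<in>UNIV. \<mu> i t \<bullet> g i t (ystar $ i)) - 2 * K\<mu> * (\<Sum>i\<in>UNIV. ?Z i))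
          - w \<bullet> (\<Sum>i\<in>UNIV. g i t (y i t)))"
      unfolding sum_distrib_left[symmetric] sum_subtractf sum.distrib inner_sum_right by simp
    ultimately show ?thesis
      using params(1) by (smt (verit) mult_left_mono)
  qed
  have "(\<Sum>i\<in>UNIV. (V1 i T - V1 i 0) + (V2 i T - V2 i 0))
      \<le> \<epsilon> * (2 * ?N * Kf * T + \<sigma> * J - w \<bullet> G)"
  proof (rule has_integral_le_AE[OF int_V int_R])
    \<comment> \<open>There are finitely many agents, so one null set serves them all.\<close>
    have "AE t in lebesgue. \<forall>i. (t \<in> {0..T} \<longrightarrow> H i t (y i t) (\<mu> i t)
          \<in> lagr_subdiff (coord_space (P i)) (Y i) (f i t) (g i t) (y i t) (\<mu> i t))
        \<and> (t \<in> {0..T} \<longrightarrow> u i t = - (K\<alpha> i *v x i t)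
          + K\<beta> i *v proj_dir (Y i) (y i t) (- \<epsilon> *\<^sub>R H i t (y i t) (\<mu> i t)))"
      using subgradient control by (intro eventually_all_finite AE_conjI)
    then show "AE t in lebesgue. t \<in> {0..T} \<longrightarrow> (\<Sum>i\<in>UNIV. D1 i t + D2 i t)
        \<le> \<epsilon> * (2 * ?N * Kf + \<sigma> * exp (- \<iota> * t) - w \<bullet> (\<Sum>i\<in>UNIV. g i t (y i t)))"
      by (rule AE_mp) (intro AE_I2 impI V_le; blast)
  qed
  moreover have "(\<Sum>i\<in>UNIV. V1 i 0) = \<Delta>\<^sup>2 / 2"
    by (simp add: V1_def \<Delta>_def sum_divide_distrib power2_norm_eq_inner
        inner_vec_def[where 'b = 'a])
  moreover have "(\<Sum>i\<in>UNIV. V2 i 0) = ?N * (norm w)\<^sup>2 / 2" by (simp add: V2_def multiplier0)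
  moreover have "(\<Sum>i\<in>UNIV. V1 i T + V2 i T) \<ge> 0" by (intro sum_nonneg) (simp add: V1_def V2_def)
  ultimately have main: "\<epsilon> * (w \<bullet> G) \<le> \<Delta>\<^sup>2 / 2 + ?N * (norm w)\<^sup>2 / 2 + \<epsilon> * (2 * ?N * Kf * T + \<sigma> * J)"
    by (simp add: sum.distrib sum_subtractf algebra_simps)
  have "w \<bullet> G = \<epsilon> / ?N * (norm (pos_part G))\<^sup>2"
    using inner_pos_part[of G] by (simp add: w_def inner_commute)
  moreover have "(norm w)\<^sup>2 = (\<epsilon> / ?N)\<^sup>2 * (norm (pos_part G))\<^sup>2"
    by (simp add: w_def power_mult_distrib power_divide)
  moreover have "\<epsilon> * (2 * ?N * Kf * T + \<sigma> * J) \<le> \<epsilon> * (2 * ?N * Kf * T + \<sigma> / \<iota>)"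
    using mult_left_mono[OF J(2), of \<sigma>] params(1,2) by (intro mult_left_mono) auto
  ultimately have "\<epsilon> * (\<epsilon> / ?N * (norm (pos_part G))\<^sup>2)
      \<le> \<Delta>\<^sup>2 / 2 + ?N * ((\<epsilon> / ?N)\<^sup>2 * (norm (pos_part G))\<^sup>2) / 2 + \<epsilon> * (2 * ?N * Kf * T + \<sigma> / \<iota>)"
    using main by simp
  \<comment> \<open>For this \<open>w\<close> the quadratic term is exactly half of the linear one,
    so half of the left-hand side survives.\<close>
  moreover have "?N * ((\<epsilon> / ?N)\<^sup>2 * (norm (pos_part G))\<^sup>2) / 2 = \<epsilon> * (\<epsilon> / ?N * (norm (pos_part G))\<^sup>2) / 2"
    by (simp add: power2_eq_square)
  ultimately have sq: "\<epsilon> * (\<epsilon> / ?N * (norm (pos_part G))\<^sup>2) \<le> \<Delta>\<^sup>2 + 2 * \<epsilon> * (2 * ?N * Kf * T + \<sigma> / \<iota>)"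
    by simp
  \<comment> \<open>Multiplied by \<open>?N / \<epsilon>\<^sup>2\<close>, the terms of
    \<open>sq\<close> with \<open>\<Delta>\<close>, \<open>\<sigma>\<close> and \<open>Kf\<close>
    become the squares of \<open>a\<close>, \<open>b\<close> and \<open>c\<close>.\<close>
  define a b c where "a = sqrt ?N * \<Delta> / \<epsilon>" and "b = sqrt (2 * ?N * \<sigma> / (\<epsilon> * \<iota>))"
    and "c = 2 * ?N * sqrt (Kf / \<epsilon>) * sqrt T"
  have nonneg: "a \<ge> 0" "b \<ge> 0" "c \<ge> 0"
    using params T bounds by (auto simp: a_def b_def c_def \<Delta>_def)
  have "(norm (pos_part G))\<^sup>2 = ?N / \<epsilon>\<^sup>2 * (\<epsilon> * (\<epsilon> / ?N * (norm (pos_part G))\<^sup>2))"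
    using params(1) by (simp add: power2_eq_square)
  also have "\<dots> \<le> ?N / \<epsilon>\<^sup>2 * (\<Delta>\<^sup>2 + 2 * \<epsilon> * (2 * ?N * Kf * T + \<sigma> / \<iota>))"
    by (rule mult_left_mono[OF sq]) simp
  also have "\<dots> = a\<^sup>2 + b\<^sup>2 + c\<^sup>2"
    using params T bounds
    by (simp add: a_def b_def c_def power_mult_distrib power_divide field_simps power2_eq_square)
  also have "\<dots> \<le> (a + b + c)\<^sup>2"
    using nonneg by (simp add: power2_sum algebra_simps)
  finally have "norm (pos_part G) \<le> a + b + c"
    by (rule power2_le_imp_le) (use nonneg in simp)
  then show ?thesis by (simp add: G_def a_def b_def c_def \<Delta>_def)
qed

end
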